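(* Let $\Phi$ be an irreducible root system with Dynkin diagram $\mathcal{D}$ and extended Dynkin diagram $\widehat{\mathcal{D}}$, and let $\Omega$ be the stabilizer of the fundamental alcove in the extended affine Weyl group. The group $\Omega$ acts on $\widehat{\mathcal{D}}$ (the Weyl part of an element of $\Omega$ permuting the set of nodes $\Pi\cup\{-\alpha_0\}$), and this gives rise to a normal inclusion $\Omega\trianglelefteq\mathrm{Aut}(\widehat{\mathcal{D}})$. Moreover, the factor group $\mathrm{Aut}(\widehat{\mathcal{D}})/\Omega$ is isomorphic to the automorphism group $\mathrm{Aut}(\mathcal{D})\le\mathrm{Aut}(\widehat{\mathcal{D}})$ of $\mathcal{D}$. In other words, there is a semi-direct product decomposition $$\mathrm{Aut}(\widehat{\mathcal{D}})\simeq\Omega\rtimes\mathrm{Aut}(\mathcal{D}).$$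
   Context: $\Phi$ is a reduced crystallographic irreducible root system in $V=\mathbb{R}\Phi$, with simple system $\Pi=\{\alpha_1,\dots,\alpha_r\}$, highest root $\alpha_0$, Weyl group $W$, and dual space $V^*$ with pairing $\langle\cdot,\cdot\rangle:V^*\times V\to\mathbb{R}$. The fundamental coweights $\varpi_i^\vee\in V^*$ satisfy $\langle\varpi_i^\vee,\alpha_k\rangle=\delta_{i,k}$, and $P^\vee=\bigoplus_i\mathbb{Z}\varpi_i^\vee$ is the coweight lattice. The extended affine Weyl group is $\widehat{W}_{\mathrm a}=P^\vee\rtimes W$ acting on $V^*$ by affine maps ($P^\vee$ by translations). The fundamental alcove is $\mathcal{A}_0=\{\lambda\in V^*:\langle\lambda,\alpha\rangle\ge0\ \forall\alpha\in\Pi,\ \langle\lambda,\alpha_0\rangle\le1\}$ and $\Omega=\{\phi\in\widehat{W}_{\mathrm a}:\phi(\mathcal{A}_0)=\mathcal{A}_0\}$. The Weyl part of $\phi=\mathrm{t}_x w$ ($x\in P^\vee$, $w\in W$, $\mathrm{t}_x$ the translation by $x$) is $w$, acting on $V$. The extended Dynkin diagram $\widehat{\mathcal{D}}$ has node set $\Pi\cup\{-\alpha_0\}$, with nodes linked (with edge multiplicities and arrows) by the usual Dynkin diagram rules; in type $A_1$ the two nodes are joined by an edge labelled $\infty$. Automorphisms of $\mathcal{D}$ and $\widehat{\mathcal{D}}$ are permutations of the nodes preserving edges with their multiplicities and arrows. $\mathrm{Aut}(\mathcal{D})$ is regarded as a subgroup of $\mathrm{Aut}(\widehat{\mathcal{D}})$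 by letting it fix the node $-\alpha_0$. *)

theory Defs
  imports "HOL-Analysis.Analysis" "HOL-Algebra.Bij" "HOL-Algebra.Generated_Groups"
    "HOL-Library.Extended_Nat"
begin

definition reflection :: "'a::euclidean_space \<Rightarrow> 'a \<Rightarrow> 'a" where
  "reflection \<alpha> v = v - (2 * (v \<bullet> \<alpha>) / (\<alpha> \<bullet> \<alpha>)) *\<^sub>R \<alpha>"

definition cartan_int :: "'a::euclidean_space \<Rightarrow> 'a \<Rightarrow> real" where
  "cartan_int \<beta> \<alpha> = 2 * (\<beta> \<bullet> \<alpha>) / (\<alpha> \<bullet> \<alpha>)"

text \<open>Reduced crystallographic root systems spanning the ambient Euclidean space.\<close>

definition root_system :: "'a::euclidean_space set \<Rightarrow> bool" where
  "root_system \<Phi> \<longleftrightarrow>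
     finite \<Phi> \<and> 0 \<notin> \<Phi> \<and> span \<Phi> = UNIV \<and>
     (\<forall>\<alpha>\<in>\<Phi>. reflection \<alpha> ` \<Phi> = \<Phi>) \<and>
     (\<forall>\<alpha>\<in>\<Phi>. \<forall>\<beta>\<in>\<Phi>. cartan_int \<beta> \<alpha> \<in> \<int>) \<and>
     (\<forall>\<alpha>\<in>\<Phi>. \<forall>c. c *\<^sub>R \<alpha> \<in> \<Phi> \<longrightarrow> c = 1 \<or> c = -1)"

definition irreducible_root_system :: "'a::euclidean_space set \<Rightarrow> bool" where
  "irreducible_root_system \<Phi> \<longleftrightarrow>
     root_system \<Phi> \<and> \<Phi> \<noteq> {} \<and>
     \<not> (\<exists>A B. A \<noteq> {} \<and> B \<noteq> {} \<and> A \<union> B = \<Phi> \<and> A \<inter> B = {} \<and> (\<forall>\<alpha>\<in>A. \<forall>\<beta>\<in>B. \<alpha> \<bullet> \<beta> = 0))"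

definition simple_system :: "'a::euclidean_space set \<Rightarrow> 'a set \<Rightarrow> bool" where
  "simple_system \<Phi> \<Delta> \<longleftrightarrow>
     \<Delta> \<subseteq> \<Phi> \<and> independent \<Delta> \<and> span \<Delta> = UNIV \<and>
     (\<forall>\<beta>\<in>\<Phi>. \<exists>c :: 'a \<Rightarrow> int. \<beta> = (\<Sum>\<alpha>\<in>\<Delta>. of_int (c \<alpha>) *\<^sub>R \<alpha>) \<and>
        ((\<forall>\<alpha>\<in>\<Delta>. c \<alpha> \<ge> 0) \<or> (\<forall>\<alpha>\<in>\<Delta>. c \<alpha> \<le> 0)))"

definition highest_root :: "'a::euclidean_space set \<Rightarrow> 'a set \<Rightarrow> 'a \<Rightarrow> bool" where
  "highest_root \<Phi> \<Delta> \<alpha>\<^sub>0 \<longleftrightarrow>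
     \<alpha>\<^sub>0 \<in> \<Phi> \<and> (\<forall>\<beta>\<in>\<Phi>. \<exists>c :: 'a \<Rightarrow> nat. \<alpha>\<^sub>0 - \<beta> = (\<Sum>\<alpha>\<in>\<Delta>. of_nat (c \<alpha>) *\<^sub>R \<alpha>))"

definition weyl_group :: "'a::euclidean_space set \<Rightarrow> ('a \<Rightarrow> 'a) set" where
  "weyl_group \<Phi> = generate (BijGroup UNIV) (reflection ` \<Phi>)"

text \<open>The dual space of \<open>V = 'a\<close> is the type \<open>'a \<Rightarrow>\<^sub>L real\<close>, and the pairing is \<open>blinfun_apply\<close>.\<close>

definition contragredient ::
  "('a::euclidean_space \<Rightarrow> 'a) \<Rightarrow> ('a \<Rightarrow>\<^sub>L real) \<Rightarrow> ('a \<Rightarrow>\<^sub>L real)" where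
  "contragredient w x = Blinfun (\<lambda>v. blinfun_apply x (inv_into UNIV w v))"

text \<open>The index \<open>\<alpha>\<close> is a simple root.\<close>

definition fundamental_coweight :: "'a::euclidean_space set \<Rightarrow> 'a \<Rightarrow> ('a \<Rightarrow>\<^sub>L real)" where
  "fundamental_coweight \<Delta> \<alpha> =
     (THE x. \<forall>\<beta>\<in>\<Delta>. blinfun_apply x \<beta> = (if \<beta> = \<alpha> then 1 else 0))"

definition coweight_lattice :: "'a::euclidean_space set \<Rightarrow> ('a \<Rightarrow>\<^sub>L real) set" where
  "coweight_lattice \<Delta> =
     range (\<lambda>c :: 'a \<Rightarrow> int. \<Sum>\<alpha>\<in>\<Delta>. of_int (c \<alpha>) *\<^sub>R fundamental_coweight \<Delta> \<alpha>)"

definition affine_weyl_elt ::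
  "('a::euclidean_space \<Rightarrow>\<^sub>L real) \<Rightarrow> ('a \<Rightarrow> 'a) \<Rightarrow> ('a \<Rightarrow>\<^sub>L real) \<Rightarrow> ('a \<Rightarrow>\<^sub>L real)" where
  "affine_weyl_elt x w = (\<lambda>y. x + contragredient w y)"

definition ext_affine_weyl_group ::
  "'a::euclidean_space set \<Rightarrow> 'a set \<Rightarrow> (('a \<Rightarrow>\<^sub>L real) \<Rightarrow> ('a \<Rightarrow>\<^sub>L real)) set" where
  "ext_affine_weyl_group \<Phi> \<Delta> =
     {affine_weyl_elt x w | x w. x \<in> coweight_lattice \<Delta> \<and> w \<in> weyl_group \<Phi>}"

definition fundamental_alcove :: "'a::euclidean_space set \<Rightarrow> 'a \<Rightarrow> ('a \<Rightarrow>\<^sub>L real) set" where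
  "fundamental_alcove \<Delta> \<alpha>\<^sub>0 =
     {x. (\<forall>\<alpha>\<in>\<Delta>. blinfun_apply x \<alpha> \<ge> 0) \<and> blinfun_apply x \<alpha>\<^sub>0 \<le> 1}"

definition alcove_stabilizer ::
  "'a::euclidean_space set \<Rightarrow> 'a set \<Rightarrow> 'a \<Rightarrow> (('a \<Rightarrow>\<^sub>L real) \<Rightarrow> ('a \<Rightarrow>\<^sub>L real)) monoid" where
  "alcove_stabilizer \<Phi> \<Delta> \<alpha>\<^sub>0 = (BijGroup UNIV)
     \<lparr>carrier := {\<phi> \<in> ext_affine_weyl_group \<Phi> \<Delta>.
        \<phi> ` fundamental_alcove \<Delta> \<alpha>\<^sub>0 = fundamental_alcove \<Delta> \<alpha>\<^sub>0}\<rparr>"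

definition weyl_part ::
  "'a::euclidean_space set \<Rightarrow> 'a set \<Rightarrow> (('a \<Rightarrow>\<^sub>L real) \<Rightarrow> ('a \<Rightarrow>\<^sub>L real)) \<Rightarrow> 'a \<Rightarrow> 'a" where
  "weyl_part \<Phi> \<Delta> \<phi> =
     (THE w. w \<in> weyl_group \<Phi> \<and> (\<exists>x\<in>coweight_lattice \<Delta>. \<phi> = affine_weyl_elt x w))"

record 'a diagram =
  nodes :: "'a set"
  edge_label :: "'a \<Rightarrow> 'a \<Rightarrow> enat"
  arrow :: "'a \<Rightarrow> 'a \<Rightarrow> bool"

text \<open>
  The label of an edge is its multiplicity, and \<open>0\<close> means that the nodes are not linked. Opposite
  roots, for which the product of the two Cartan integers is \<open>4\<close>, get the label \<open>\<infinity>\<close>; among the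
  nodes of a (possibly extended) Dynkin diagram this happens only for the extended diagram of
  type \<open>A\<^sub>1\<close>. Arrows point from the longer to the shorter root.
\<close>

definition dynkin_diagram :: "'a::euclidean_space set \<Rightarrow> 'a diagram" where
  "dynkin_diagram S =
     \<lparr>nodes = S,
      edge_label = (\<lambda>\<alpha> \<beta>. if \<alpha> = \<beta> then 0 else if \<alpha> = - \<beta> then \<infinity>
                     else enat (nat \<lfloor>cartan_int \<alpha> \<beta> * cartan_int \<beta> \<alpha>\<rfloor>)),
      arrow = (\<lambda>\<alpha> \<beta>. \<alpha> \<bullet> \<beta> \<noteq> 0 \<and> norm \<alpha> > norm \<beta>)\<rparr>"

definition extended_dynkin_diagram :: "'a::euclidean_space set \<Rightarrow> 'a \<Rightarrow> 'a diagram" where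
  "extended_dynkin_diagram \<Delta> \<alpha>\<^sub>0 = dynkin_diagram (insert (- \<alpha>\<^sub>0) \<Delta>)"

definition diagram_auts :: "'a diagram \<Rightarrow> ('a \<Rightarrow> 'a) monoid" where
  "diagram_auts D = (BijGroup (nodes D))
     \<lparr>carrier := {\<sigma> \<in> Bij (nodes D). \<forall>\<alpha>\<in>nodes D. \<forall>\<beta>\<in>nodes D.
        edge_label D (\<sigma> \<alpha>) (\<sigma> \<beta>) = edge_label D \<alpha> \<beta> \<and>
        (arrow D (\<sigma> \<alpha>) (\<sigma> \<beta>) \<longleftrightarrow> arrow D \<alpha> \<beta>)}\<rparr>"

text \<open>The embedding of automorphisms of the Dynkin diagram that lets them fix \<open>- \<alpha>\<^sub>0\<close>.\<close>

definition extend_aut :: "'a::euclidean_space set \<Rightarrow> 'a \<Rightarrow> ('a \<Rightarrow> 'a) \<Rightarrow> ('a \<Rightarrow> 'a)" where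
  "extend_aut \<Delta> \<alpha>\<^sub>0 \<sigma> =
     (\<lambda>\<beta>\<in>insert (- \<alpha>\<^sub>0) \<Delta>. if \<beta> = - \<alpha>\<^sub>0 then - \<alpha>\<^sub>0 else \<sigma> \<beta>)"

definition node_action ::
  "'a::euclidean_space set \<Rightarrow> 'a set \<Rightarrow> 'a \<Rightarrow> (('a \<Rightarrow>\<^sub>L real) \<Rightarrow> ('a \<Rightarrow>\<^sub>L real)) \<Rightarrow> ('a \<Rightarrow> 'a)" where
  "node_action \<Phi> \<Delta> \<alpha>\<^sub>0 \<phi> = restrict (weyl_part \<Phi> \<Delta> \<phi>) (insert (- \<alpha>\<^sub>0) \<Delta>)"

text \<open>The action \<open>\<theta>\<close> is meant to be a homomorphism from \<open>H\<close> to \<open>AutoGroup N\<close>.\<close>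

definition semidirect_product ::
  "('n, 'c) monoid_scheme \<Rightarrow> ('h, 'd) monoid_scheme \<Rightarrow> ('h \<Rightarrow> 'n \<Rightarrow> 'n) \<Rightarrow> ('n \<times> 'h) monoid" where
  "semidirect_product N H \<theta> =
     \<lparr>carrier = carrier N \<times> carrier H,
      monoid.mult = (\<lambda>(n, h) (n', h'). (n \<otimes>\<^bsub>N\<^esub> \<theta> h n', h \<otimes>\<^bsub>H\<^esub> h')),
      one = (\<one>\<^bsub>N\<^esub>, \<one>\<^bsub>H\<^esub>)\<rparr>"

end

theory Submission
  imports Defs
begin

text \<open>
  Write \<open>E = \<Delta> \<union> {- \<alpha>\<^sub>0}\<close>. The proof identifies all three groups with groups of linear maps.

  For roots at pairwise non-acute angles the edge multiplicities and arrows determine the Cartan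
  integers, so a diagram automorphism is a permutation of the nodes that preserves them
  (\<open>dynkin_aut_iff_cartan_int\<close>). The marks \<open>m\<^sub>\<beta>\<close> with \<open>\<Sum>\<^sub>E m\<^sub>\<beta> \<beta> = 0\<close> and \<open>m = 1\<close> at \<open>- \<alpha>\<^sub>0\<close> are the
  coefficients of the highest root. If a permutation \<open>\<sigma>\<close> of \<open>E\<close> preserves the Cartan integers, then
  \<open>\<Sum>\<^sub>E m\<^sub>\<beta> \<sigma>(\<beta>)\<close> is orthogonal to all of \<open>E\<close>, hence zero; so the linear map agreeing with \<open>\<sigma>\<close> on \<open>\<Delta>\<close>
  agrees with it on \<open>E\<close>. Thus the automorphisms of the extended diagram are the restrictions of the
  automorphisms of \<open>\<Phi>\<close> that stabilize \<open>E\<close> (\<open>AutE_carrier\<close>), and those of the Dynkin diagram are the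
  restrictions of the automorphisms that stabilize \<open>\<Delta>\<close>; the latter fix \<open>\<alpha>\<^sub>0\<close> and hence stabilize
  \<open>E\<close>.

  The alcove stabilizer corresponds to the elements of the Weyl group that stabilize \<open>E\<close>
  (\<open>affine_stabilizes_alcove_iff\<close>, \<open>ex_alcove_stabilizer\<close>). For \<open>\<beta> \<in> E\<close> let \<open>f\<^sub>\<beta>\<close> be the affine function
  \<open>\<beta>\<close> if \<open>\<beta> \<in> \<Delta>\<close> and \<open>1 - \<alpha>\<^sub>0\<close> if \<open>\<beta> = - \<alpha>\<^sub>0\<close>, so that the alcove is where all \<open>f\<^sub>\<beta>\<close> are nonnegative and
  \<open>\<Sum>\<^sub>E m\<^sub>\<beta> f\<^sub>\<beta> = 1\<close>. If \<open>\<phi>\<close> stabilizes the alcove, each \<open>f\<^sub>\<beta> \<circ> \<phi> = \<gamma> + k\<close>, with \<open>\<gamma>\<close> a root and \<open>k\<close> an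
  integer, is nonnegative on the alcove and vanishes somewhere on it. The affine height
  \<open>ht \<gamma> + (1 + ht \<alpha>\<^sub>0) k\<close> of such a function is at least \<open>1\<close>, with equality only for the \<open>f\<^sub>\<beta>\<close>
  (\<open>affine_root_tight_on_alcove\<close>). As the weighted sum of these heights is
  \<open>1 + ht \<alpha>\<^sub>0 = \<Sum>\<^sub>E m\<^sub>\<beta>\<close>, all of them equal \<open>1\<close>, and \<open>\<phi>\<close> permutes the functions \<open>f\<^sub>\<beta>\<close>. Conversely, an
  automorphism of \<open>\<Phi>\<close> that stabilizes \<open>E\<close> preserves the marks (\<open>mark_root_aut\<close>), and this gives the
  translation part belonging to a given element of the Weyl group.

  The rest is the decomposition of the automorphism group of \<open>\<Phi>\<close> into the Weyl group, which is
  normal (\<open>root_aut_conj_weyl\<close>), and the automorphisms that stabilize \<open>\<Delta>\<close>. Every automorphism can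
  be moved into the stabilizer of \<open>\<Delta>\<close> by the Weyl group (\<open>weyl_transitive\<close>), and only the identity
  of the Weyl group lies in that stabilizer (\<open>weyl_eq_id_if_simple_pos\<close>). Restricted to the
  automorphisms that stabilize \<open>E\<close>, this is the semidirect decomposition, by a general lemma on
  split extensions (\<open>split_extension_semidirect\<close>).
\<close>

section \<open>Split extensions of groups\<close>

text \<open>
  A group that is the product of a normal subgroup, the image of \<open>N\<close>, and a complement, the image
  of \<open>H\<close>. The action of \<open>H\<close> on \<open>N\<close> is conjugation in \<open>G\<close>, transported along \<open>f\<close>.
\<close>

lemma split_extension_semidirect:
  assumes "group G" "group N" "group H"
    and f: "f \<in> mon N G" and K: "f ` carrier N \<lhd> G" and g: "g \<in> mon H G"
    and triv: "f ` carrier N \<inter> g ` carrier H \<subseteq> {\<one>\<^bsub>G\<^esub>}"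
    and gen: "\<And>x. x \<in> carrier G \<Longrightarrow> \<exists>n\<in>carrier N. \<exists>h\<in>carrier H. x = f n \<otimes>\<^bsub>G\<^esub> g h"
  shows "(G Mod (f ` carrier N)) \<cong> H"
    and "\<exists>\<theta> \<in> hom H (AutoGroup N).
           (\<lambda>(n, h). f n \<otimes>\<^bsub>G\<^esub> g h) \<in> iso (semidirect_product N H \<theta>) G"
proof -
  interpret G: group G by fact
  interpret N: group N by fact
  interpret H: group H by fact
  define K where "K = f ` carrier N"
  interpret K: normal K G using K by (simp add: K_def)
  have f_hom: "f \<in> hom N G" and f_inj: "inj_on f (carrier N)"
    and g_hom: "g \<in> hom H G" and g_inj: "inj_on g (carrier H)"
    using f g by (auto simp: mon_def)
  interpret f: group_hom N G f by unfold_locales (rule f_hom)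
  interpret g: group_hom H G g by unfold_locales (rule g_hom)
  have fK: "f n \<in> K" if "n \<in> carrier N" for n using that by (simp add: K_def)
  have disj: "h = h'" if "h \<in> carrier H" "h' \<in> carrier H"
    "g h \<otimes>\<^bsub>G\<^esub> inv\<^bsub>G\<^esub> (g h') \<in> K" for h h'
  proof -
    have "g h \<otimes>\<^bsub>G\<^esub> inv\<^bsub>G\<^esub> (g h') = g (h \<otimes>\<^bsub>H\<^esub> inv\<^bsub>H\<^esub> h')" using that by simp
    hence "g h \<otimes>\<^bsub>G\<^esub> inv\<^bsub>G\<^esub> (g h') = \<one>\<^bsub>G\<^esub>"
      using triv that imageI[of "h \<otimes>\<^bsub>H\<^esub> inv\<^bsub>H\<^esub> h'" "carrier H" g] unfolding K_def by auto
    hence "g h = g h'" using that G.inv_solve_right'[of "\<one>\<^bsub>G\<^esub>" "g h" "g h'"] by simp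
    thus ?thesis using that(1,2) by (simp add: inj_on_eq_iff[OF g_inj])
  qed

  let ?p = "\<lambda>h. K #>\<^bsub>G\<^esub> g h"
  have "?p \<in> hom H (G Mod K)"
    using hom_compose[OF g_hom K.r_coset_hom_Mod] by (simp add: comp_def)
  moreover have "inj_on ?p (carrier H)"
  proof (rule inj_onI)
    fix h h' assume h: "h \<in> carrier H" "h' \<in> carrier H" and eq: "?p h = ?p h'"
    have "g h \<in> K #>\<^bsub>G\<^esub> g h'" using G.rcos_self[OF _ K.subgroup_axioms, of "g h"] h
      unfolding eq by simp
    then obtain k where "k \<in> K" "g h = k \<otimes>\<^bsub>G\<^esub> g h'" by (auto simp: r_coset_def)
    hence "g h \<otimes>\<^bsub>G\<^esub> inv\<^bsub>G\<^esub> (g h') = k"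
      using h G.inv_solve_right'[of k "g h" "g h'"] by simp
    with \<open>k \<in> K\<close> show "h = h'" using disj h by blast
  qed
  moreover have "?p ` carrier H = carrier (G Mod K)"
  proof
    show "?p ` carrier H \<subseteq> carrier (G Mod K)"
      using \<open>?p \<in> hom H (G Mod K)\<close> by (auto simp: hom_def)
    show "carrier (G Mod K) \<subseteq> ?p ` carrier H"
    proof
      fix C assume "C \<in> carrier (G Mod K)"
      then obtain x where x: "x \<in> carrier G" "C = K #>\<^bsub>G\<^esub> x"
        by (auto simp: FactGroup_def RCOSETS_def)
      obtain n h where nh: "n \<in> carrier N" "h \<in> carrier H" "x = f n \<otimes>\<^bsub>G\<^esub> g h"
        using gen[OF x(1)] by blast
      have "C = (K #>\<^bsub>G\<^esub> f n) #>\<^bsub>G\<^esub> g h"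
        using nh x by (simp add: G.coset_mult_assoc[OF K.subset])
      also have "K #>\<^bsub>G\<^esub> f n = K"
        using fK[OF nh(1)] by (simp add: G.coset_join2 K.subgroup_axioms nh(1))
      finally show "C \<in> ?p ` carrier H" using nh by blast
    qed
  qed
  ultimately have "?p \<in> iso H (G Mod K)" by (simp add: iso_def bij_betw_def)
  hence "H \<cong> G Mod K" by (auto simp: is_iso_def)
  thus "(G Mod (f ` carrier N)) \<cong> H" unfolding K_def[symmetric] by (rule H.iso_sym)

  have cancel: "inv\<^bsub>G\<^esub> (g h) \<otimes>\<^bsub>G\<^esub> (g h \<otimes>\<^bsub>G\<^esub> x) = x"
    if "h \<in> carrier H" "x \<in> carrier G" for h x
    using that by (simp flip: G.m_assoc)
  define c where "c h n = g h \<otimes>\<^bsub>G\<^esub> f n \<otimes>\<^bsub>G\<^esub> inv\<^bsub>G\<^esub> (g h)" for h n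
  define \<theta> where "\<theta> h = (\<lambda>n\<in>carrier N. inv_into (carrier N) f (c h n))" for h
  have cK: "c h n \<in> f ` carrier N" if "h \<in> carrier H" "n \<in> carrier N" for h n
    using K.inv_op_closed2[of "g h" "f n"] that fK by (simp add: c_def K_def)
  have \<theta>_cl: "\<theta> h n \<in> carrier N" if "h \<in> carrier H" "n \<in> carrier N" for h n
    using inv_into_into[OF cK[OF that]] that by (simp add: \<theta>_def)
  have f\<theta>: "f (\<theta> h n) = c h n" if "h \<in> carrier H" "n \<in> carrier N" for h n
    using f_inv_into_f[OF cK[OF that]] that by (simp add: \<theta>_def)
  have f_eq: "n = n'" if "n \<in> carrier N" "n' \<in> carrier N" "f n = f n'" for n n'
    using f_inj that by (meson inj_onD)
  have \<theta>_hom: "\<theta> h (n \<otimes>\<^bsub>N\<^esub> n') = \<theta> h n \<otimes>\<^bsub>N\<^esub> \<theta> h n'"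
    if "h \<in> carrier H" "n \<in> carrier N" "n' \<in> carrier N" for h n n'
    using that by (intro f_eq) (simp_all add: \<theta>_cl f\<theta> c_def G.m_assoc cancel)
  have \<theta>_comp: "\<theta> (h \<otimes>\<^bsub>H\<^esub> h') n = \<theta> h (\<theta> h' n)"
    if "h \<in> carrier H" "h' \<in> carrier H" "n \<in> carrier N" for h h' n
    using that by (intro f_eq) (simp_all add: \<theta>_cl f\<theta> c_def G.m_assoc G.inv_mult_group)
  have \<theta>_one: "\<theta> \<one>\<^bsub>H\<^esub> n = n" if "n \<in> carrier N" for n
    using that by (intro f_eq) (simp_all add: \<theta>_cl f\<theta> c_def)
  have bij: "bij_betw (\<theta> h) (carrier N) (carrier N)" if h: "h \<in> carrier H" for h
    by (rule bij_betw_byWitness[where f' = "\<theta> (inv\<^bsub>H\<^esub> h)"])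
      (auto simp: h \<theta>_cl \<theta>_one simp flip: \<theta>_comp)
  have Bij: "\<theta> h \<in> Bij (carrier N)" if h: "h \<in> carrier H" for h
    using bij[OF h] by (simp add: Bij_def \<theta>_def)
  have "\<theta> \<in> hom H (AutoGroup N)"
  proof (rule homI)
    show "\<theta> h \<in> carrier (AutoGroup N)" if "h \<in> carrier H" for h
      using that Bij by (auto simp: AutoGroup_def auto_def hom_def \<theta>_cl \<theta>_hom)
    show "\<theta> (h \<otimes>\<^bsub>H\<^esub> h') = \<theta> h \<otimes>\<^bsub>AutoGroup N\<^esub> \<theta> h'"
      if "h \<in> carrier H" "h' \<in> carrier H" for h h'
    proof (rule extensionalityI[where A = "carrier N"])
      show "\<theta> (h \<otimes>\<^bsub>H\<^esub> h') \<in> extensional (carrier N)" by (simp add: \<theta>_def)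
    qed (use that in \<open>auto simp: AutoGroup_def BijGroup_def Bij \<theta>_comp compose_def\<close>)
  qed
  moreover have "(\<lambda>(n, h). f n \<otimes>\<^bsub>G\<^esub> g h) \<in> iso (semidirect_product N H \<theta>) G"
  proof (rule isoI)
    show "(\<lambda>(n, h). f n \<otimes>\<^bsub>G\<^esub> g h) \<in> hom (semidirect_product N H \<theta>) G"
    proof (rule homI, goal_cases)
      case (1 x)
      thus ?case by (auto simp: semidirect_product_def)
    next
      case (2 x y)
      obtain n h n' h' where xy: "x = (n, h)" "y = (n', h')" by fastforce
      with 2 have cl: "n \<in> carrier N" "h \<in> carrier H" "n' \<in> carrier N" "h' \<in> carrier H"
        by (auto simp: semidirect_product_def)
      thus ?case using xy
        by (simp add: semidirect_product_def f\<theta> \<theta>_cl c_def G.m_assoc cancel)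
    qed
    show "bij_betw (\<lambda>(n, h). f n \<otimes>\<^bsub>G\<^esub> g h) (carrier (semidirect_product N H \<theta>)) (carrier G)"
    proof (rule bij_betw_imageI)
      show "inj_on (\<lambda>(n, h). f n \<otimes>\<^bsub>G\<^esub> g h) (carrier (semidirect_product N H \<theta>))"
      proof (rule inj_onI, clarsimp simp: semidirect_product_def)
        fix n h n' h'
        assume cl: "n \<in> carrier N" "h \<in> carrier H" "n' \<in> carrier N" "h' \<in> carrier H"
          and eq: "f n \<otimes>\<^bsub>G\<^esub> g h = f n' \<otimes>\<^bsub>G\<^esub> g h'"
        have "g h \<otimes>\<^bsub>G\<^esub> inv\<^bsub>G\<^esub> (g h') = inv\<^bsub>G\<^esub> (f n) \<otimes>\<^bsub>G\<^esub> (f n \<otimes>\<^bsub>G\<^esub> g h) \<otimes>\<^bsub>G\<^esub> inv\<^bsub>G\<^esub> (g h')"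
          using cl by (simp flip: G.m_assoc)
        also have "\<dots> = inv\<^bsub>G\<^esub> (f n) \<otimes>\<^bsub>G\<^esub> f n'"
          unfolding eq using cl by (simp add: G.m_assoc)
        also have "\<dots> \<in> K" using cl fK by (simp add: K.m_inv_closed)
        finally have hh: "h = h'" using disj cl by blast
        with eq cl have "f n = f n'" by simp
        with hh cl show "n = n' \<and> h = h'" using f_eq by blast
      qed
      show "(\<lambda>(n, h). f n \<otimes>\<^bsub>G\<^esub> g h) ` carrier (semidirect_product N H \<theta>) = carrier G"
        using gen by (fastforce simp: semidirect_product_def image_iff)
    qed
  qed
  ultimately show "\<exists>\<theta> \<in> hom H (AutoGroup N).
      (\<lambda>(n, h). f n \<otimes>\<^bsub>G\<^esub> g h) \<in> iso (semidirect_product N H \<theta>) G" by blast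
qed

section \<open>Reflections and Cartan integers\<close>

lemma reflection_cartan_int: "reflection \<alpha> v = v - cartan_int v \<alpha> *\<^sub>R \<alpha>"
  by (simp add: reflection_def cartan_int_def)

lemma cartan_int_add_left: "cartan_int (u + v) \<alpha> = cartan_int u \<alpha> + cartan_int v \<alpha>"
  by (simp add: cartan_int_def inner_add_left add_divide_distrib algebra_simps)

lemma cartan_int_scaleR_left: "cartan_int (c *\<^sub>R v) \<alpha> = c * cartan_int v \<alpha>"
  by (simp add: cartan_int_def)

lemma cartan_int_minus_left: "cartan_int (- v) \<alpha> = - cartan_int v \<alpha>"
  by (simp add: cartan_int_def)

lemma cartan_int_minus_right: "cartan_int v (- \<alpha>) = - cartan_int v \<alpha>"
  by (simp add: cartan_int_def)

lemma linear_cartan_int: "linear (\<lambda>v. cartan_int v \<alpha>)"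
  by (rule linearI) (simp_all add: cartan_int_add_left cartan_int_scaleR_left)

lemma linear_reflection: "linear (reflection \<alpha>)"
  by (rule linearI)
    (simp_all add: reflection_cartan_int cartan_int_add_left cartan_int_scaleR_left algebra_simps)

lemma cartan_int_self [simp]: "\<alpha> \<noteq> 0 \<Longrightarrow> cartan_int \<alpha> \<alpha> = 2"
  by (simp add: cartan_int_def)

lemma reflection_self: "reflection \<alpha> \<alpha> = - \<alpha>"
  by (cases "\<alpha> = 0") (auto simp: reflection_cartan_int scaleR_2)

lemma reflection_inner: "reflection \<alpha> u \<bullet> reflection \<alpha> v = u \<bullet> v"
  by (cases "\<alpha> = 0")
    (auto simp: reflection_def inner_diff_left inner_diff_right inner_commute field_simps)

lemma reflection_reflection [simp]: "reflection \<alpha> (reflection \<alpha> v) = v"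
  by (cases "\<alpha> = 0")
    (auto simp: reflection_cartan_int cartan_int_def inner_diff_left algebra_simps)

lemma bij_reflection: "bij (reflection \<alpha>)"
  by (rule o_bij[of "reflection \<alpha>"]) auto

lemma reflection_isometry:
  assumes "linear w" "\<And>u v. w u \<bullet> w v = u \<bullet> v"
  shows "reflection (w \<alpha>) (w v) = w (reflection \<alpha> v)"
  using assms by (simp add: reflection_def linear_diff linear_scale)

text \<open>
  The ratio of the two Cartan integers is the ratio of the squared lengths of the roots.
\<close>

lemma arrow_iff_cartan_int:
  assumes "\<alpha> \<noteq> 0" "\<beta> \<noteq> 0"
  shows "\<alpha> \<bullet> \<beta> \<noteq> 0 \<and> norm \<beta> < norm \<alpha> \<longleftrightarrow> \<bar>cartan_int \<beta> \<alpha>\<bar> < \<bar>cartan_int \<alpha> \<beta>\<bar>"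
proof -
  have "norm \<beta> < norm \<alpha> \<longleftrightarrow> \<beta> \<bullet> \<beta> < \<alpha> \<bullet> \<alpha>" by (simp add: norm_lt)
  moreover have "0 < \<alpha> \<bullet> \<alpha>" "0 < \<beta> \<bullet> \<beta>" using assms by auto
  ultimately show ?thesis
    by (cases "\<alpha> \<bullet> \<beta> = 0")
      (auto simp: cartan_int_def inner_commute abs_mult field_simps mult_less_cancel_left_pos)
qed

section \<open>Root systems with a simple system\<close>

locale based_root_system =
  fixes \<Phi> \<Delta> :: "'a::euclidean_space set"
  assumes root_system: "root_system \<Phi>" and simple_system: "simple_system \<Phi> \<Delta>"
begin

lemma finite_roots: "finite \<Phi>" and zero_nonroot: "0 \<notin> \<Phi>" and span_roots: "span \<Phi> = UNIV"
  and reflection_image: "\<alpha> \<in> \<Phi> \<Longrightarrow> reflection \<alpha> ` \<Phi> = \<Phi>"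
  and cartan_int_Ints: "\<alpha> \<in> \<Phi> \<Longrightarrow> \<beta> \<in> \<Phi> \<Longrightarrow> cartan_int \<beta> \<alpha> \<in> \<int>"
  and reduced: "\<alpha> \<in> \<Phi> \<Longrightarrow> c *\<^sub>R \<alpha> \<in> \<Phi> \<Longrightarrow> c = 1 \<or> c = -1"
  using root_system by (auto simp: root_system_def)

lemma root_nonzero: "\<alpha> \<in> \<Phi> \<Longrightarrow> \<alpha> \<noteq> 0"
  using zero_nonroot by blast

lemma reflection_root: "\<alpha> \<in> \<Phi> \<Longrightarrow> \<beta> \<in> \<Phi> \<Longrightarrow> reflection \<alpha> \<beta> \<in> \<Phi>"
  using reflection_image by blast

lemma uminus_root: "\<alpha> \<in> \<Phi> \<Longrightarrow> - \<alpha> \<in> \<Phi>"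
  using reflection_root[of \<alpha> \<alpha>] by (simp add: reflection_self)

lemma simple_roots: "\<Delta> \<subseteq> \<Phi>" and independent_simple: "independent \<Delta>"
  and span_simple: "span \<Delta> = UNIV"
  using simple_system by (auto simp: simple_system_def)

lemma simple_root: "\<alpha> \<in> \<Delta> \<Longrightarrow> \<alpha> \<in> \<Phi>"
  using simple_roots by blast

lemma finite_simple: "finite \<Delta>"
  using simple_roots finite_roots finite_subset by blast

lemma linear_eq_simple:
  assumes "linear f" "linear g" "\<And>\<alpha>. \<alpha> \<in> \<Delta> \<Longrightarrow> f \<alpha> = g \<alpha>"
  shows "f = g"
  using linear_eq_on_span[OF assms(1,2), of \<Delta>] assms(3) span_simple by auto

text \<open>
  The coordinates with respect to the simple roots are the fundamental coweights; this makes them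
  elements of the dual space.
\<close>

abbreviation coeff :: "'a \<Rightarrow> 'a \<Rightarrow> real" where
  "coeff \<alpha> \<equiv> blinfun_apply (fundamental_coweight \<Delta> \<alpha>)"

lemma blinfun_eq_simple:
  assumes "\<And>\<alpha>. \<alpha> \<in> \<Delta> \<Longrightarrow> blinfun_apply x \<alpha> = blinfun_apply y \<alpha>"
  shows "x = y"
  using linear_eq_simple[OF blinfun.bounded_linear_right[THEN bounded_linear.linear]
      blinfun.bounded_linear_right[THEN bounded_linear.linear] assms]
  by (simp add: blinfun_apply_inject)

lemma ex_blinfun_simple: "\<exists>x :: 'a \<Rightarrow>\<^sub>L real. \<forall>\<beta>\<in>\<Delta>. blinfun_apply x \<beta> = f \<beta>"
proof -
  obtain g :: "'a \<Rightarrow> real" where g: "linear g" "\<forall>\<beta>\<in>\<Delta>. g \<beta> = f \<beta>"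
    using linear_independent_extend[OF independent_simple] by blast
  thus ?thesis
    by (intro exI[of _ "Blinfun g"]) (simp add: bounded_linear_Blinfun_apply linear_conv_bounded_linear)
qed

lemma coeff_simple: "\<beta> \<in> \<Delta> \<Longrightarrow> coeff \<alpha> \<beta> = (if \<beta> = \<alpha> then 1 else 0)"
proof -
  obtain x :: "'a \<Rightarrow>\<^sub>L real" where "\<forall>\<beta>\<in>\<Delta>. blinfun_apply x \<beta> = (if \<beta> = \<alpha> then 1 else 0)"
    using ex_blinfun_simple[of "\<lambda>\<beta>. if \<beta> = \<alpha> then 1 else 0"] by blast
  hence "\<exists>!x :: 'a \<Rightarrow>\<^sub>L real. \<forall>\<beta>\<in>\<Delta>. blinfun_apply x \<beta> = (if \<beta> = \<alpha> then 1 else 0)"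
    by (intro ex1I[of _ x] blinfun_eq_simple) auto
  from theI'[OF this] show "\<beta> \<in> \<Delta> \<Longrightarrow> coeff \<alpha> \<beta> = (if \<beta> = \<alpha> then 1 else 0)"
    by (simp add: fundamental_coweight_def)
qed

lemma coeff_expansion: "v = (\<Sum>\<alpha>\<in>\<Delta>. coeff \<alpha> v *\<^sub>R \<alpha>)"
proof -
  have "(\<lambda>v. v) = (\<lambda>v. \<Sum>\<alpha>\<in>\<Delta>. coeff \<alpha> v *\<^sub>R \<alpha>)"
  proof (rule linear_eq_simple)
    show "linear (\<lambda>v. \<Sum>\<alpha>\<in>\<Delta>. coeff \<alpha> v *\<^sub>R \<alpha>)"
      by (rule linearI)
        (simp_all add: blinfun.add_right blinfun.scaleR_right scaleR_left_distrib
          sum.distrib scaleR_sum_right)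
    fix \<beta> assume "\<beta> \<in> \<Delta>"
    have "(\<Sum>\<alpha>\<in>\<Delta>. coeff \<alpha> \<beta> *\<^sub>R \<alpha>) = (\<Sum>\<alpha>\<in>\<Delta>. if \<alpha> = \<beta> then \<alpha> else 0)"
      using \<open>\<beta> \<in> \<Delta>\<close> by (intro sum.cong) (auto simp: coeff_simple)
    thus "\<beta> = (\<Sum>\<alpha>\<in>\<Delta>. coeff \<alpha> \<beta> *\<^sub>R \<alpha>)" using \<open>\<beta> \<in> \<Delta>\<close> finite_simple by simp
  qed (rule linear_ident)
  thus ?thesis by (rule fun_cong)
qed

lemma linear_expansion: "linear f \<Longrightarrow> f v = (\<Sum>\<alpha>\<in>\<Delta>. coeff \<alpha> v *\<^sub>R f \<alpha>)"
  using arg_cong[OF coeff_expansion, of f v] by (simp add: linear_sum linear_scale)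

lemma orthogonal_simple_eq_0:
  assumes "\<And>\<alpha>. \<alpha> \<in> \<Delta> \<Longrightarrow> v \<bullet> \<alpha> = 0" shows "v = 0"
proof -
  have "v \<bullet> v = (\<Sum>\<alpha>\<in>\<Delta>. coeff \<alpha> v * (v \<bullet> \<alpha>))"
    using linear_expansion[of "\<lambda>u. v \<bullet> u" v]
    by (simp add: bounded_linear.linear bounded_linear_inner_right)
  thus ?thesis using assms by simp
qed

lemma coeff_sum: "\<alpha> \<in> \<Delta> \<Longrightarrow> coeff \<alpha> (\<Sum>\<beta>\<in>\<Delta>. c \<beta> *\<^sub>R \<beta>) = c \<alpha>"
proof -
  assume "\<alpha> \<in> \<Delta>"
  have "coeff \<alpha> (\<Sum>\<beta>\<in>\<Delta>. c \<beta> *\<^sub>R \<beta>) = (\<Sum>\<beta>\<in>\<Delta>. c \<beta> * coeff \<alpha> \<beta>)"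
    by (simp add: blinfun.sum_right blinfun.scaleR_right)
  also have "\<dots> = (\<Sum>\<beta>\<in>\<Delta>. if \<beta> = \<alpha> then c \<beta> else 0)"
    by (intro sum.cong) (auto simp: coeff_simple)
  finally show ?thesis using \<open>\<alpha> \<in> \<Delta>\<close> finite_simple by simp
qed

lemma coeff_eq_imp_eq: "(\<And>\<alpha>. \<alpha> \<in> \<Delta> \<Longrightarrow> coeff \<alpha> u = coeff \<alpha> v) \<Longrightarrow> u = v"
  using coeff_expansion[of u] coeff_expansion[of v] by (metis (no_types, lifting) sum.cong)

lemma root_coeff_cases:
  assumes "\<beta> \<in> \<Phi>"
  obtains "\<And>\<alpha>. \<alpha> \<in> \<Delta> \<Longrightarrow> coeff \<alpha> \<beta> \<ge> 0" | "\<And>\<alpha>. \<alpha> \<in> \<Delta> \<Longrightarrow> coeff \<alpha> \<beta> \<le> 0"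
proof -
  obtain c :: "'a \<Rightarrow> int" where c: "\<beta> = (\<Sum>\<alpha>\<in>\<Delta>. of_int (c \<alpha>) *\<^sub>R \<alpha>)"
      "(\<forall>\<alpha>\<in>\<Delta>. c \<alpha> \<ge> 0) \<or> (\<forall>\<alpha>\<in>\<Delta>. c \<alpha> \<le> 0)"
    using simple_system assms unfolding simple_system_def by blast
  have "coeff \<alpha> \<beta> = of_int (c \<alpha>)" if "\<alpha> \<in> \<Delta>" for \<alpha>
    using that by (simp add: c(1) coeff_sum)
  thus ?thesis using that c(2) by auto
qed

lemma coeff_root_Ints: "\<beta> \<in> \<Phi> \<Longrightarrow> \<alpha> \<in> \<Delta> \<Longrightarrow> coeff \<alpha> \<beta> \<in> \<int>"
proof -
  assume "\<beta> \<in> \<Phi>" "\<alpha> \<in> \<Delta>"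
  obtain c :: "'a \<Rightarrow> int" where "\<beta> = (\<Sum>\<alpha>\<in>\<Delta>. of_int (c \<alpha>) *\<^sub>R \<alpha>)"
    using simple_system \<open>\<beta> \<in> \<Phi>\<close> unfolding simple_system_def by blast
  hence "coeff \<alpha> \<beta> = of_int (c \<alpha>)" using \<open>\<alpha> \<in> \<Delta>\<close> by (simp add: coeff_sum)
  thus ?thesis by simp
qed

text \<open>
  The positive roots.
\<close>

definition pos :: "'a set" where
  "pos = {\<beta> \<in> \<Phi>. \<forall>\<alpha>\<in>\<Delta>. coeff \<alpha> \<beta> \<ge> 0}"

lemma pos_root: "\<beta> \<in> pos \<Longrightarrow> \<beta> \<in> \<Phi>"
  by (simp add: pos_def)

lemma finite_pos: "finite pos"
  using finite_roots by (simp add: pos_def)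

lemma simple_pos: "\<alpha> \<in> \<Delta> \<Longrightarrow> \<alpha> \<in> pos"
  by (simp add: pos_def simple_root coeff_simple)

lemma pos_cases: "\<beta> \<in> \<Phi> \<Longrightarrow> \<beta> \<in> pos \<or> - \<beta> \<in> pos"
  by (rule root_coeff_cases[of \<beta>]) (auto simp: pos_def uminus_root blinfun.minus_right)

lemma coeff_pos_positive:
  assumes "\<beta> \<in> pos" obtains \<alpha> where "\<alpha> \<in> \<Delta>" "coeff \<alpha> \<beta> > 0"
proof (rule ccontr)
  assume "\<not> thesis"
  hence "coeff \<alpha> \<beta> = 0" if "\<alpha> \<in> \<Delta>" for \<alpha>
    using assms that \<open>\<And>\<alpha>. \<alpha> \<in> \<Delta> \<Longrightarrow> 0 < coeff \<alpha> \<beta> \<Longrightarrow> thesis\<close> by (force simp: pos_def)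
  hence "\<beta> = 0" by (intro coeff_eq_imp_eq) simp
  thus False using assms root_nonzero pos_root by blast
qed

lemma uminus_not_pos: "\<beta> \<in> pos \<Longrightarrow> - \<beta> \<notin> pos"
  by (erule coeff_pos_positive) (force simp: pos_def blinfun.minus_right)

lemma root_pos_if_coeff_pos:
  assumes "\<beta> \<in> \<Phi>" "\<alpha> \<in> \<Delta>" "coeff \<alpha> \<beta> > 0" shows "\<beta> \<in> pos"
  using pos_cases[OF assms(1)] assms(2,3) by (auto simp: pos_def blinfun.minus_right)

text \<open>The height, the sum of the coordinates, as an element of the dual space.\<close>

definition ht :: "'a \<Rightarrow>\<^sub>L real" where
  "ht = (\<Sum>\<alpha>\<in>\<Delta>. fundamental_coweight \<Delta> \<alpha>)"

lemma ht_eq: "ht v = (\<Sum>\<alpha>\<in>\<Delta>. coeff \<alpha> v)"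
  by (simp add: ht_def blinfun.sum_left)

lemma ht_simple [simp]: "\<alpha> \<in> \<Delta> \<Longrightarrow> ht \<alpha> = 1"
  using finite_simple by (simp add: ht_eq coeff_simple)

lemma ht_Ints: "\<beta> \<in> \<Phi> \<Longrightarrow> ht \<beta> \<in> \<int>"
  unfolding ht_eq by (rule Ints_sum) (rule coeff_root_Ints)

lemma ht_pos_ge_1: "\<beta> \<in> pos \<Longrightarrow> ht \<beta> \<ge> 1"
proof -
  assume \<beta>: "\<beta> \<in> pos"
  obtain \<alpha> where \<alpha>: "\<alpha> \<in> \<Delta>" "coeff \<alpha> \<beta> > 0" using coeff_pos_positive[OF \<beta>] .
  have "coeff \<alpha> \<beta> \<in> \<int>" using \<beta> \<alpha> coeff_root_Ints pos_root by blast
  hence "1 \<le> coeff \<alpha> \<beta>" using \<alpha>(2) by (auto elim: Ints_cases)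
  also have "\<dots> \<le> ht \<beta>" unfolding ht_eq
    using \<alpha>(1) \<beta> finite_simple by (intro member_le_sum) (auto simp: pos_def)
  finally show ?thesis .
qed

lemma ht_1_simple:
  assumes \<beta>: "\<beta> \<in> pos" and ht: "ht \<beta> = 1" shows "\<beta> \<in> \<Delta>"
proof -
  obtain \<alpha> where \<alpha>: "\<alpha> \<in> \<Delta>" "coeff \<alpha> \<beta> > 0" using coeff_pos_positive[OF \<beta>] .
  have "coeff \<alpha> \<beta> \<in> \<int>" using \<beta> \<alpha> coeff_root_Ints pos_root by blast
  hence ge: "1 \<le> coeff \<alpha> \<beta>" using \<alpha>(2) by (auto elim: Ints_cases)
  have split: "ht \<beta> = coeff \<alpha> \<beta> + (\<Sum>\<gamma>\<in>\<Delta> - {\<alpha>}. coeff \<gamma> \<beta>)"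
    unfolding ht_eq using \<alpha>(1) finite_simple by (simp add: sum.remove)
  have nn: "coeff \<gamma> \<beta> \<ge> 0" if "\<gamma> \<in> \<Delta> - {\<alpha>}" for \<gamma> using that \<beta> by (simp add: pos_def)
  hence "(\<Sum>\<gamma>\<in>\<Delta> - {\<alpha>}. coeff \<gamma> \<beta>) \<ge> 0" by (rule sum_nonneg)
  with ge split ht have *: "(\<Sum>\<gamma>\<in>\<Delta> - {\<alpha>}. coeff \<gamma> \<beta>) = 0" and 1: "coeff \<alpha> \<beta> = 1" by auto
  have "coeff \<gamma> \<beta> = 0" if "\<gamma> \<in> \<Delta> - {\<alpha>}" for \<gamma>
    using * nn that finite_simple by (subst (asm) sum_nonneg_eq_0_iff) auto
  hence "\<beta> = \<alpha>" using 1 \<alpha> by (intro coeff_eq_imp_eq) (auto simp: coeff_simple)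
  thus ?thesis using \<alpha> by simp
qed

lemma simple_inner_nonpos:
  assumes "\<alpha> \<in> \<Delta>" "\<beta> \<in> \<Delta>" "\<alpha> \<noteq> \<beta>" shows "\<alpha> \<bullet> \<beta> \<le> 0"
proof (rule ccontr)
  assume "\<not> \<alpha> \<bullet> \<beta> \<le> 0"
  hence c: "cartan_int \<beta> \<alpha> > 0"
    using assms(1) simple_root root_nonzero by (auto simp: cartan_int_def inner_commute)
  have r: "reflection \<alpha> \<beta> \<in> \<Phi>" using assms simple_root reflection_root by blast
  have "coeff \<beta> (reflection \<alpha> \<beta>) = 1" "coeff \<alpha> (reflection \<alpha> \<beta>) = - cartan_int \<beta> \<alpha>"
    using assms by (auto simp: reflection_cartan_int blinfun.diff_right blinfun.scaleR_right coeff_simple)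
  with c root_pos_if_coeff_pos[OF r assms(2)] assms(1) show False by (force simp: pos_def)
qed

lemma simple_reflection_permutes_pos:
  assumes "\<alpha> \<in> \<Delta>" "\<beta> \<in> pos" "\<beta> \<noteq> \<alpha>" shows "reflection \<alpha> \<beta> \<in> pos"
proof -
  have "\<exists>\<gamma>\<in>\<Delta>. \<gamma> \<noteq> \<alpha> \<and> coeff \<gamma> \<beta> > 0"
  proof (rule ccontr)
    assume "\<not> ?thesis"
    hence "coeff \<gamma> \<beta> = 0" if "\<gamma> \<in> \<Delta>" "\<gamma> \<noteq> \<alpha>" for \<gamma> using that assms(2) by (force simp: pos_def)
    hence eq: "\<beta> = coeff \<alpha> \<beta> *\<^sub>R \<alpha>"
      by (intro coeff_eq_imp_eq) (use assms(1) in \<open>auto simp: blinfun.scaleR_right coeff_simple\<close>)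
    hence "coeff \<alpha> \<beta> = 1 \<or> coeff \<alpha> \<beta> = -1"
      using reduced[of \<alpha> "coeff \<alpha> \<beta>"] assms simple_root pos_root by simp
    moreover have "coeff \<alpha> \<beta> \<ge> 0" using assms by (simp add: pos_def)
    ultimately show False using eq assms(3) by auto
  qed
  then obtain \<gamma> where \<gamma>: "\<gamma> \<in> \<Delta>" "\<gamma> \<noteq> \<alpha>" "coeff \<gamma> \<beta> > 0" by blast
  moreover have "coeff \<gamma> (reflection \<alpha> \<beta>) = coeff \<gamma> \<beta>"
    using \<gamma> assms(1) by (simp add: reflection_cartan_int blinfun.diff_right blinfun.scaleR_right coeff_simple)
  ultimately show ?thesis
    using assms simple_root pos_root reflection_root by (intro root_pos_if_coeff_pos[of _ \<gamma>]) auto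
qed

text \<open>
  Since \<open>\<beta> \<bullet> \<beta> > 0\<close>, some simple root with positive coefficient in \<open>\<beta>\<close> has positive inner product
  with \<open>\<beta>\<close>. (If \<open>\<beta>\<close> is simple, then this is \<open>\<beta>\<close> itself, and the reflected root is negative.)
\<close>

lemma pos_descent:
  assumes "\<beta> \<in> pos" obtains \<alpha> where "\<alpha> \<in> \<Delta>" "ht (reflection \<alpha> \<beta>) < ht \<beta>"
proof -
  have "0 < \<beta> \<bullet> \<beta>" using assms pos_root root_nonzero by auto
  also have "\<beta> \<bullet> \<beta> = (\<Sum>\<alpha>\<in>\<Delta>. coeff \<alpha> \<beta> * (\<alpha> \<bullet> \<beta>))"
    using linear_expansion[of "\<lambda>v. v \<bullet> \<beta>" \<beta>] by (simp add: bounded_linear.linear bounded_linear_inner_left)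
  finally obtain \<alpha> where \<alpha>: "\<alpha> \<in> \<Delta>" "coeff \<alpha> \<beta> * (\<alpha> \<bullet> \<beta>) > 0"
    by (meson not_less sum_nonpos)
  moreover have "coeff \<alpha> \<beta> \<ge> 0" using assms \<alpha>(1) by (simp add: pos_def)
  ultimately have "\<alpha> \<bullet> \<beta> > 0" by (simp add: zero_less_mult_iff)
  hence "cartan_int \<beta> \<alpha> > 0"
    using \<alpha>(1) simple_root root_nonzero by (auto simp: cartan_int_def inner_commute)
  hence "ht (reflection \<alpha> \<beta>) < ht \<beta>"
    using \<alpha>(1) by (simp add: reflection_cartan_int blinfun.diff_right blinfun.scaleR_right)
  thus ?thesis using that \<alpha> by blast
qed

text \<open>
  Every root is obtained from a simple root by simple reflections.
\<close>

lemma root_induct [consumes 1, case_names simple reflection]: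
  assumes "\<beta> \<in> \<Phi>"
    and simple: "\<And>\<alpha>. \<alpha> \<in> \<Delta> \<Longrightarrow> P \<alpha>"
    and refl: "\<And>\<alpha> \<beta>. \<alpha> \<in> \<Delta> \<Longrightarrow> \<beta> \<in> \<Phi> \<Longrightarrow> P \<beta> \<Longrightarrow> P (reflection \<alpha> \<beta>)"
  shows "P \<beta>"
proof -
  have *: "P \<gamma> \<and> P (- \<gamma>)" if "\<gamma> \<in> pos" for \<gamma>
    using that
  proof (induction "nat \<lfloor>ht \<gamma>\<rfloor>" arbitrary: \<gamma> rule: less_induct)
    case less
    show ?case
    proof (cases "\<gamma> \<in> \<Delta>")
      case True
      thus ?thesis using simple refl[of \<gamma> \<gamma>] simple_root by (simp add: reflection_self)
    next
      case False
      obtain \<alpha> where \<alpha>: "\<alpha> \<in> \<Delta>" "ht (reflection \<alpha> \<gamma>) < ht \<gamma>" using pos_descent[OF less.prems] .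
      have p: "reflection \<alpha> \<gamma> \<in> pos" using simple_reflection_permutes_pos \<alpha>(1) less.prems False by blast
      have "\<lfloor>ht (reflection \<alpha> \<gamma>)\<rfloor> < \<lfloor>ht \<gamma>\<rfloor>"
        using \<alpha>(2) ht_Ints[OF pos_root[OF p]] ht_Ints[OF pos_root[OF less.prems]]
        by (auto elim!: Ints_cases)
      moreover have "\<lfloor>ht \<gamma>\<rfloor> > 0" using ht_pos_ge_1[OF less.prems] by linarith
      ultimately have "P (reflection \<alpha> \<gamma>) \<and> P (- reflection \<alpha> \<gamma>)"
        using p by (intro less.hyps) auto
      hence "P (reflection \<alpha> (reflection \<alpha> \<gamma>)) \<and> P (reflection \<alpha> (- reflection \<alpha> \<gamma>))"
        using refl \<alpha>(1) p pos_root uminus_root by blast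
      thus ?thesis by (simp add: linear_neg[OF linear_reflection])
    qed
  qed
  show ?thesis using pos_cases[OF assms(1)] *[of \<beta>] *[of "- \<beta>"] by auto
qed

end

section \<open>The Weyl group\<close>

lemma Bij_UNIV: "Bij UNIV = {f. bij f}"
  by (auto simp: Bij_def)

lemma BijGroup_UNIV_mult: "bij f \<Longrightarrow> bij g \<Longrightarrow> f \<otimes>\<^bsub>BijGroup UNIV\<^esub> g = f \<circ> g"
  by (simp add: BijGroup_def Bij_UNIV compose_def restrict_UNIV comp_def)

lemma BijGroup_UNIV_one: "\<one>\<^bsub>BijGroup UNIV\<^esub> = id"
  by (auto simp: BijGroup_def)

lemma BijGroup_UNIV_inv: "bij f \<Longrightarrow> inv\<^bsub>BijGroup UNIV\<^esub> f = inv_into UNIV f"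
  by (simp add: inv_BijGroup Bij_UNIV restrict_UNIV)

text \<open>
  The product of the reflections in a list of vectors; the last one is applied first.
\<close>

definition word :: "'a::euclidean_space list \<Rightarrow> 'a \<Rightarrow> 'a" where
  "word \<alpha>s = foldr (\<lambda>\<alpha> w. reflection \<alpha> \<circ> w) \<alpha>s id"

lemma word_Nil: "word [] = id" and word_Cons: "word (\<alpha> # \<alpha>s) = reflection \<alpha> \<circ> word \<alpha>s"
  by (simp_all add: word_def)

lemma word_apply [simp]: "word [] v = v" "word (\<alpha> # \<alpha>s) v = reflection \<alpha> (word \<alpha>s v)"
  by (simp_all add: word_def)

lemma word_singleton: "word [\<alpha>] = reflection \<alpha>"
  by (simp add: fun_eq_iff)

lemma word_append: "word (\<alpha>s @ \<beta>s) v = word \<alpha>s (word \<beta>s v)"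
  by (induction \<alpha>s) simp_all

lemma word_append_comp: "word (\<alpha>s @ \<beta>s) = word \<alpha>s \<circ> word \<beta>s"
  by (simp add: fun_eq_iff word_append)

lemma linear_word: "linear (word \<alpha>s)"
proof (induction \<alpha>s)
  case Nil
  show ?case unfolding word_Nil by (rule linear_id)
next
  case (Cons \<alpha> \<alpha>s)
  show ?case unfolding word_Cons by (rule linear_compose[OF Cons.IH linear_reflection])
qed

lemma word_inner: "word \<alpha>s u \<bullet> word \<alpha>s v = u \<bullet> v"
  by (induction \<alpha>s) (simp_all add: reflection_inner)

lemma word_rev: "word (rev \<alpha>s) (word \<alpha>s v) = v"
  by (induction \<alpha>s arbitrary: v) (simp_all add: word_append)

lemma bij_word: "bij (word \<alpha>s)"
  using word_rev[of \<alpha>s] word_rev[of "rev \<alpha>s"]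
  by (intro o_bij[of "word (rev \<alpha>s)"]) (auto simp: fun_eq_iff)

lemma inv_word: "inv_into UNIV (word \<alpha>s) = word (rev \<alpha>s)"
  using word_rev[of \<alpha>s] word_rev[of "rev \<alpha>s"]
  by (intro inv_unique_comp) (auto simp: fun_eq_iff)

context based_root_system
begin

lemma word_in_weyl_group: "set \<alpha>s \<subseteq> \<Phi> \<Longrightarrow> word \<alpha>s \<in> weyl_group \<Phi>"
proof (induction \<alpha>s)
  case Nil
  show ?case using generate.one[of "BijGroup UNIV" "reflection ` \<Phi>"]
    by (simp only: weyl_group_def BijGroup_UNIV_one word_Nil)
next
  case (Cons \<alpha> \<alpha>s)
  hence "reflection \<alpha> \<otimes>\<^bsub>BijGroup UNIV\<^esub> word \<alpha>s \<in> weyl_group \<Phi>"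
    unfolding weyl_group_def by (auto intro: generate.eng generate.incl)
  thus ?case by (simp only: BijGroup_UNIV_mult[OF bij_reflection bij_word] word_Cons)
qed

lemma reflection_is_simple_word:
  assumes "\<beta> \<in> \<Phi>" shows "\<exists>\<alpha>s. set \<alpha>s \<subseteq> \<Delta> \<and> reflection \<beta> = word \<alpha>s"
  using assms
proof (induction rule: root_induct)
  case (simple \<alpha>)
  thus ?case by (intro exI[of _ "[\<alpha>]"]) (simp add: word_singleton)
next
  case (reflection \<alpha> \<beta>)
  then obtain \<alpha>s where \<alpha>s: "set \<alpha>s \<subseteq> \<Delta>" "reflection \<beta> = word \<alpha>s" by blast
  have "reflection (reflection \<alpha> \<beta>) v = reflection \<alpha> (reflection \<beta> (reflection \<alpha> v))" for v
    using reflection_isometry[OF linear_reflection reflection_inner, of \<alpha> \<beta> "reflection \<alpha> v"]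
    by simp
  hence "reflection (reflection \<alpha> \<beta>) = word (\<alpha> # \<alpha>s @ [\<alpha>])"
    by (simp add: fun_eq_iff word_append \<alpha>s)
  moreover have "set (\<alpha> # \<alpha>s @ [\<alpha>]) \<subseteq> \<Delta>" using \<alpha>s reflection by simp
  ultimately show ?case by blast
qed

text \<open>
  The Weyl group is generated by the simple reflections.
\<close>

lemma weyl_group_simple_words: "weyl_group \<Phi> = word ` {\<alpha>s. set \<alpha>s \<subseteq> \<Delta>}"
proof
  show "word ` {\<alpha>s. set \<alpha>s \<subseteq> \<Delta>} \<subseteq> weyl_group \<Phi>"
    using word_in_weyl_group simple_roots by blast
  show "weyl_group \<Phi> \<subseteq> word ` {\<alpha>s. set \<alpha>s \<subseteq> \<Delta>}"
  proof
    fix w assume "w \<in> weyl_group \<Phi>"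
    thus "w \<in> word ` {\<alpha>s. set \<alpha>s \<subseteq> \<Delta>}"
      unfolding weyl_group_def
    proof (induction rule: generate.induct)
      case one
      show ?case by (rule image_eqI[of _ _ "[]"]) (simp_all only: BijGroup_UNIV_one word_Nil, simp)
    next
      case (incl w)
      thus ?case using reflection_is_simple_word by blast
    next
      case (inv w)
      then obtain \<beta> where \<beta>: "\<beta> \<in> \<Phi>" "w = reflection \<beta>" by blast
      moreover have "inv_into UNIV (reflection \<beta>) = reflection \<beta>"
        using inv_word[of "[\<beta>]"] by (simp add: word_singleton)
      ultimately show ?case
        using reflection_is_simple_word[OF \<beta>(1)] bij_reflection[of \<beta>]
        by (auto simp: BijGroup_UNIV_inv)
    next
      case (eng w w')
      then obtain \<alpha>s \<beta>s where "set \<alpha>s \<subseteq> \<Delta>" "w = word \<alpha>s" "set \<beta>s \<subseteq> \<Delta>" "w' = word \<beta>s"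
        by blast
      moreover from this have "w \<otimes>\<^bsub>BijGroup UNIV\<^esub> w' = word (\<alpha>s @ \<beta>s)"
        using BijGroup_UNIV_mult[OF bij_word bij_word, of \<alpha>s \<beta>s]
        by (simp add: word_append_comp)
      ultimately show ?case by auto
    qed
  qed
qed

lemma weyl_groupE:
  assumes "w \<in> weyl_group \<Phi>" obtains \<alpha>s where "set \<alpha>s \<subseteq> \<Delta>" "w = word \<alpha>s"
  using assms unfolding weyl_group_simple_words by blast

lemma weyl_id: "id \<in> weyl_group \<Phi>"
  using word_in_weyl_group[of "[]"] by (simp add: word_Nil)

lemma weyl_comp: "w \<in> weyl_group \<Phi> \<Longrightarrow> w' \<in> weyl_group \<Phi> \<Longrightarrow> w \<circ> w' \<in> weyl_group \<Phi>"
proof (elim weyl_groupE)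
  fix \<alpha>s \<beta>s assume *: "set \<alpha>s \<subseteq> \<Delta>" "w = word \<alpha>s" "set \<beta>s \<subseteq> \<Delta>" "w' = word \<beta>s"
  have "word (\<alpha>s @ \<beta>s) \<in> weyl_group \<Phi>"
    using * simple_roots by (intro word_in_weyl_group) auto
  also have "word (\<alpha>s @ \<beta>s) = w \<circ> w'" using * by (simp add: fun_eq_iff word_append)
  finally show ?thesis .
qed

lemma weyl_inv: "w \<in> weyl_group \<Phi> \<Longrightarrow> inv_into UNIV w \<in> weyl_group \<Phi>"
using word_in_weyl_group simple_roots by (elim weyl_groupE) (simp add: inv_word order_trans)

lemma weyl_linear: "w \<in> weyl_group \<Phi> \<Longrightarrow> linear w"
  by (elim weyl_groupE) (simp add: linear_word)

lemma weyl_bij: "w \<in> weyl_group \<Phi> \<Longrightarrow> bij w"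
  by (elim weyl_groupE) (simp add: bij_word)

section \<open>Automorphisms of the root system\<close>

text \<open>
  The linear automorphisms of the root system. Preservation of the Cartan integers follows from
  the other two conditions, but it is convenient to have it in the definition.
\<close>

definition root_auts :: "('a \<Rightarrow> 'a) set" where
  "root_auts = {A. linear A \<and> A ` \<Phi> = \<Phi> \<and>
     (\<forall>\<alpha>\<in>\<Phi>. \<forall>\<beta>\<in>\<Phi>. cartan_int (A \<alpha>) (A \<beta>) = cartan_int \<alpha> \<beta>)}"

lemma root_aut_linear: "A \<in> root_auts \<Longrightarrow> linear A"
  and root_aut_image: "A \<in> root_auts \<Longrightarrow> A ` \<Phi> = \<Phi>"
  and root_aut_cartan_int: "A \<in> root_auts \<Longrightarrow> \<alpha> \<in> \<Phi> \<Longrightarrow> \<beta> \<in> \<Phi> \<Longrightarrow>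
        cartan_int (A \<alpha>) (A \<beta>) = cartan_int \<alpha> \<beta>"
  by (simp_all add: root_auts_def)

lemma root_aut_root: "A \<in> root_auts \<Longrightarrow> \<beta> \<in> \<Phi> \<Longrightarrow> A \<beta> \<in> \<Phi>"
  using root_aut_image by blast

lemma root_aut_bij:
  assumes A: "A \<in> root_auts" shows "bij A"
proof -
  have "range A = span (A ` \<Phi>)"
    using linear_span_image[OF root_aut_linear[OF A], of \<Phi>] span_roots by simp
  hence "surj A" using root_aut_image[OF A] span_roots by simp
  thus ?thesis
    using linear_surj_imp_inj[OF root_aut_linear[OF A]] by (simp add: bij_def)
qed

lemma root_aut_reflection:
  assumes A: "A \<in> root_auts" and \<beta>: "\<beta> \<in> \<Phi>"
  shows "A (reflection \<beta> v) = reflection (A \<beta>) (A v)"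
proof -
  have "A \<circ> reflection \<beta> = reflection (A \<beta>) \<circ> A"
  proof (rule linear_eq_simple)
    show "(A \<circ> reflection \<beta>) \<alpha> = (reflection (A \<beta>) \<circ> A) \<alpha>" if "\<alpha> \<in> \<Delta>" for \<alpha>
      using that A \<beta> simple_root root_aut_linear
      by (simp add: reflection_cartan_int root_aut_cartan_int linear_diff linear_scale)
  qed (intro linear_compose linear_reflection root_aut_linear[OF A])+
  thus ?thesis by (simp add: fun_eq_iff)
qed

lemma root_aut_comp: "A \<in> root_auts \<Longrightarrow> B \<in> root_auts \<Longrightarrow> A \<circ> B \<in> root_auts"
proof -
  assume A: "A \<in> root_auts" and B: "B \<in> root_auts"
  have "(A \<circ> B) ` \<Phi> = \<Phi>"
    by (simp only: image_comp[symmetric] root_aut_image[OF A] root_aut_image[OF B])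
  thus "A \<circ> B \<in> root_auts"
    using linear_compose[OF root_aut_linear[OF B] root_aut_linear[OF A]] root_aut_root[OF B]
    by (simp add: root_auts_def root_aut_cartan_int[OF A] root_aut_cartan_int[OF B])
qed

lemma root_aut_inv:
  assumes A: "A \<in> root_auts" shows "inv_into UNIV A \<in> root_auts"
proof -
  note bij = root_aut_bij[OF A]
  have img: "inv_into UNIV A ` \<Phi> = \<Phi>"
    using image_inv_f_f[OF bij_is_inj[OF bij], of \<Phi>] root_aut_image[OF A] by simp
  have "linear (inv_into UNIV A)"
    using inj_linear_imp_inv_linear[OF root_aut_linear[OF A]] bij by (simp add: bij_def)
  moreover have "cartan_int (inv_into UNIV A \<alpha>) (inv_into UNIV A \<beta>) = cartan_int \<alpha> \<beta>"
    if "\<alpha> \<in> \<Phi>" "\<beta> \<in> \<Phi>" for \<alpha> \<beta>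
  proof -
    have "inv_into UNIV A \<alpha> \<in> \<Phi>" "inv_into UNIV A \<beta> \<in> \<Phi>" using that img by blast+
    from root_aut_cartan_int[OF A this] show ?thesis
      by (simp add: surj_f_inv_f[OF bij_is_surj[OF bij]])
  qed
  ultimately show ?thesis using img by (simp add: root_auts_def)
qed

lemma weyl_root_aut:
  assumes "w \<in> weyl_group \<Phi>" shows "w \<in> root_auts"
proof -
  obtain \<alpha>s where \<alpha>s: "set \<alpha>s \<subseteq> \<Delta>" "w = word \<alpha>s" using weyl_groupE[OF assms] .
  have "word \<alpha>s ` \<Phi> = \<Phi>" using \<alpha>s(1)
  proof (induction \<alpha>s)
    case (Cons \<alpha> \<alpha>s)
    thus ?case using reflection_image[of \<alpha>] simple_root
      by (simp only: word_Cons image_comp[symmetric]) simp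
  qed simp
  thus ?thesis by (simp add: \<alpha>s root_auts_def linear_word cartan_int_def word_inner)
qed

lemma root_aut_word:
  "A \<in> root_auts \<Longrightarrow> set \<alpha>s \<subseteq> \<Phi> \<Longrightarrow> A \<circ> word \<alpha>s = word (map A \<alpha>s) \<circ> A"
  by (induction \<alpha>s) (auto simp: fun_eq_iff root_aut_reflection)

lemma root_aut_conj_weyl:
  assumes A: "A \<in> root_auts" and w: "w \<in> weyl_group \<Phi>"
  shows "A \<circ> w \<circ> inv_into UNIV A \<in> weyl_group \<Phi>"
proof -
  obtain \<alpha>s where \<alpha>s: "set \<alpha>s \<subseteq> \<Delta>" "w = word \<alpha>s" using weyl_groupE[OF w] .
  have "A \<circ> w \<circ> inv_into UNIV A = word (map A \<alpha>s) \<circ> (A \<circ> inv_into UNIV A)"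
    using root_aut_word[OF A, of \<alpha>s] \<alpha>s simple_roots by (auto simp: o_assoc)
  also have "A \<circ> inv_into UNIV A = id"
    using root_aut_bij[OF A] by (simp add: bij_is_surj surj_iff[symmetric])
  finally have "A \<circ> w \<circ> inv_into UNIV A = word (map A \<alpha>s)" by (simp only: comp_id)
  moreover have "word (map A \<alpha>s) \<in> weyl_group \<Phi>"
    using \<alpha>s simple_root root_aut_root[OF A] by (intro word_in_weyl_group) auto
  ultimately show ?thesis by (simp only:)
qed

text \<open>
  A linear map into \<open>\<Phi>\<close> on \<open>\<Delta>\<close> that preserves the Cartan integers of \<open>\<Delta>\<close> intertwines the simple
  reflections of \<open>\<Delta>\<close> with those of its image, hence, by \<open>root_induct\<close>, all reflections.
\<close>

lemma root_autI:
  assumes lin: "linear A" and img: "\<And>\<alpha>. \<alpha> \<in> \<Delta> \<Longrightarrow> A \<alpha> \<in> \<Phi>"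
    and cart: "\<And>\<alpha> \<beta>. \<alpha> \<in> \<Delta> \<Longrightarrow> \<beta> \<in> \<Delta> \<Longrightarrow> cartan_int (A \<alpha>) (A \<beta>) = cartan_int \<alpha> \<beta>"
  shows "A \<in> root_auts"
proof -
  have simple: "A (reflection \<alpha> v) = reflection (A \<alpha>) (A v)" if \<alpha>: "\<alpha> \<in> \<Delta>" for \<alpha> v
  proof -
    have "A \<circ> reflection \<alpha> = reflection (A \<alpha>) \<circ> A"
    proof (rule linear_eq_simple)
      show "(A \<circ> reflection \<alpha>) \<beta> = (reflection (A \<alpha>) \<circ> A) \<beta>" if "\<beta> \<in> \<Delta>" for \<beta>
        using that \<alpha> lin by (simp add: reflection_cartan_int cart linear_diff linear_scale)
    qed (intro linear_compose linear_reflection lin)+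
    thus ?thesis by (simp add: fun_eq_iff)
  qed
  have *: "A \<beta> \<in> \<Phi> \<and> (\<forall>v. A (reflection \<beta> v) = reflection (A \<beta>) (A v))" if "\<beta> \<in> \<Phi>" for \<beta>
    using that
  proof (induction rule: root_induct)
    case (simple \<alpha>)
    thus ?case using img \<open>\<And>\<alpha> v. \<alpha> \<in> \<Delta> \<Longrightarrow> A (reflection \<alpha> v) = reflection (A \<alpha>) (A v)\<close> by blast
  next
    case (reflection \<alpha> \<beta>)
    have conj: "reflection (reflection \<gamma> \<delta>) v = reflection \<gamma> (reflection \<delta> (reflection \<gamma> v))"
      for \<gamma> \<delta> v :: 'a
      using reflection_isometry[OF linear_reflection reflection_inner, of \<gamma> \<delta> "reflection \<gamma> v"]
      by simp
    have "A (reflection \<alpha> \<beta>) = reflection (A \<alpha>) (A \<beta>)" using reflection simple by blast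
    moreover have "A (reflection (reflection \<alpha> \<beta>) v) = reflection (A (reflection \<alpha> \<beta>)) (A v)" for v
      using reflection by (simp only: simple conj)
    ultimately show ?case using reflection img[of \<alpha>] by (simp add: reflection_root)
  qed
  have cart': "cartan_int (A \<alpha>) (A \<beta>) = cartan_int \<alpha> \<beta>" if "\<alpha> \<in> \<Phi>" "\<beta> \<in> \<Phi>" for \<alpha> \<beta>
  proof -
    have "cartan_int \<alpha> \<beta> *\<^sub>R A \<beta> = A \<alpha> - A (reflection \<beta> \<alpha>)"
      using lin by (simp add: reflection_cartan_int linear_diff linear_scale)
    also have "\<dots> = cartan_int (A \<alpha>) (A \<beta>) *\<^sub>R A \<beta>"
      using *[OF that(2)] by (simp add: reflection_cartan_int[of "A \<beta>" "A \<alpha>"])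
    finally show ?thesis using *[OF that(2)] root_nonzero by auto
  qed
  \<comment> \<open>A vector in the kernel has Cartan integer zero with every simple root.\<close>
  have "inj A"
  proof (subst linear_injective_0[OF lin], intro allI impI)
    fix v assume "A v = 0"
    have "v \<bullet> \<alpha> = 0" if "\<alpha> \<in> \<Delta>" for \<alpha>
    proof -
      have "linear (\<lambda>v. cartan_int (A v) (A \<alpha>))"
        using linear_compose[OF lin linear_cartan_int] by (simp add: o_def)
      hence "(\<lambda>v. cartan_int (A v) (A \<alpha>)) = (\<lambda>v. cartan_int v \<alpha>)"
        by (rule linear_eq_simple) (simp_all add: linear_cartan_int cart that)
      from fun_cong[OF this, of v] \<open>A v = 0\<close> show ?thesis
        using that simple_root root_nonzero by (auto simp: cartan_int_def)
    qed
    thus "v = 0" by (rule orthogonal_simple_eq_0)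
  qed
  hence "inj_on A \<Phi>" by (rule inj_on_subset) simp
  hence "A ` \<Phi> = \<Phi>" using * finite_roots by (intro endo_inj_surj) auto
  with lin cart' show ?thesis by (simp add: root_auts_def)
qed

lemma root_aut_ht_ge:
  assumes A: "A \<in> root_auts" and pos: "\<And>\<alpha>. \<alpha> \<in> \<Delta> \<Longrightarrow> A \<alpha> \<in> pos" and \<beta>: "\<beta> \<in> pos"
  shows "ht (A \<beta>) \<ge> ht \<beta>"
proof -
  have "ht \<beta> \<le> (\<Sum>\<alpha>\<in>\<Delta>. coeff \<alpha> \<beta> * ht (A \<alpha>))"
    unfolding ht_eq[of \<beta>]
  proof (rule sum_mono)
    fix \<alpha> assume "\<alpha> \<in> \<Delta>"
    with \<beta> ht_pos_ge_1[OF pos, of \<alpha>] show "coeff \<alpha> \<beta> \<le> coeff \<alpha> \<beta> * ht (A \<alpha>)"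
      using mult_left_mono[of 1 "ht (A \<alpha>)" "coeff \<alpha> \<beta>"] by (simp add: pos_def)
  qed
  also have "\<dots> = ht (A \<beta>)"
    using linear_expansion[OF root_aut_linear[OF A], of \<beta>]
    by (simp add: blinfun.sum_right blinfun.scaleR_right)
  finally show ?thesis .
qed

text \<open>
  Such a map cannot lower heights, and neither can its inverse; hence it preserves the height, and
  the simple roots are the positive roots of height one.
\<close>

lemma root_aut_pos_simple:
  assumes A: "A \<in> root_auts" and pos: "A ` pos \<subseteq> pos"
  shows "A ` \<Delta> = \<Delta>"
proof -
  have inj: "inj A" using root_aut_bij[OF A] by (simp add: bij_def)
  have img: "A ` pos = pos"
    using finite_pos pos by (intro endo_inj_surj inj_on_subset[OF inj]) auto
  hence ipos: "inv_into UNIV A \<beta> \<in> pos" if "\<beta> \<in> pos" for \<beta>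
    using that inj by (metis inv_f_f imageE)
  have "A \<alpha> \<in> \<Delta>" if \<alpha>: "\<alpha> \<in> \<Delta>" for \<alpha>
  proof (rule ht_1_simple)
    show p: "A \<alpha> \<in> pos" using \<alpha> simple_pos pos by blast
    have "ht (A \<alpha>) \<le> ht (inv_into UNIV A (A \<alpha>))"
      using root_aut_inv[OF A] ipos simple_pos p by (intro root_aut_ht_ge) auto
    also have "\<dots> = 1" using \<alpha> inj by simp
    finally show "ht (A \<alpha>) = 1" using ht_pos_ge_1[OF p] by simp
  qed
  thus ?thesis
    using finite_simple by (intro endo_inj_surj inj_on_subset[OF inj]) auto
qed

lemma root_aut_pos_if_simple:
  assumes A: "A \<in> root_auts" and pos: "\<And>\<alpha>. \<alpha> \<in> \<Delta> \<Longrightarrow> A \<alpha> \<in> pos"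
  shows "A ` pos \<subseteq> pos"
proof
  fix \<gamma> assume "\<gamma> \<in> A ` pos"
  then obtain \<beta> where \<beta>: "\<beta> \<in> pos" "\<gamma> = A \<beta>" by blast
  have "coeff \<delta> \<gamma> \<ge> 0" if "\<delta> \<in> \<Delta>" for \<delta>
    using \<beta> linear_expansion[OF root_aut_linear[OF A], of \<beta>] pos that
    by (simp add: blinfun.sum_right blinfun.scaleR_right pos_def sum_nonneg)
  thus "\<gamma> \<in> pos" using \<beta> root_aut_root[OF A] by (simp add: pos_def)
qed

text \<open>
  By induction on the number of positive roots that \<open>A\<close> makes negative: if the simple root \<open>\<alpha>\<close> is one
  of them, then \<open>A \<circ> reflection \<alpha>\<close> makes fewer positive roots negative, because \<open>reflection \<alpha>\<close> permutes
  the positive roots other than \<open>\<alpha>\<close>.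
\<close>

lemma weyl_transitive:
  assumes "A \<in> root_auts"
  shows "\<exists>w\<in>weyl_group \<Phi>. (A \<circ> w) ` \<Delta> = \<Delta>"
  using assms
proof (induction "card {\<beta> \<in> pos. A \<beta> \<notin> pos}" arbitrary: A rule: less_induct)
  case less
  show ?case
  proof (cases "\<forall>\<alpha>\<in>\<Delta>. A \<alpha> \<in> pos")
    case True
    hence "(A \<circ> id) ` \<Delta> = \<Delta>"
      using root_aut_pos_simple root_aut_pos_if_simple less.prems by simp
    thus ?thesis using weyl_id by blast
  next
    case False
    then obtain \<alpha> where \<alpha>: "\<alpha> \<in> \<Delta>" "A \<alpha> \<notin> pos" by blast
    have "\<alpha> \<in> \<Phi>" using \<alpha> simple_root by blast
    have s: "reflection \<alpha> \<in> weyl_group \<Phi>"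
      using word_in_weyl_group[of "[\<alpha>]"] \<open>\<alpha> \<in> \<Phi>\<close> by (simp add: word_singleton)
    let ?B = "A \<circ> reflection \<alpha>"
    let ?N = "\<lambda>A. {\<beta> \<in> pos. A \<beta> \<notin> pos}"
    have B: "?B \<in> root_auts" using root_aut_comp less.prems weyl_root_aut s by blast
    have "?B \<alpha> \<in> pos"
      using \<alpha>(2) pos_cases[OF root_aut_root[OF less.prems \<open>\<alpha> \<in> \<Phi>\<close>]]
      by (simp add: reflection_self linear_neg[OF root_aut_linear[OF less.prems]])
    have "reflection \<alpha> ` ?N ?B \<subseteq> ?N A - {\<alpha>}"
    proof clarsimp
      fix \<beta> assume \<beta>: "\<beta> \<in> pos" "A (reflection \<alpha> \<beta>) \<notin> pos"
      with \<open>?B \<alpha> \<in> pos\<close> have "\<beta> \<noteq> \<alpha>" by auto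
      moreover have "reflection \<alpha> \<beta> \<noteq> \<alpha>"
      proof
        assume "reflection \<alpha> \<beta> = \<alpha>"
        hence "\<beta> = - \<alpha>" by (metis reflection_reflection reflection_self)
        thus False using \<beta> \<alpha>(1) uminus_not_pos simple_pos by blast
      qed
      ultimately show "reflection \<alpha> \<beta> \<in> pos \<and> reflection \<alpha> \<beta> \<noteq> \<alpha>"
        using simple_reflection_permutes_pos \<alpha> \<beta> by blast
    qed
    hence "card (reflection \<alpha> ` ?N ?B) \<le> card (?N A - {\<alpha>})"
      using finite_pos by (intro card_mono) auto
    also have "card (reflection \<alpha> ` ?N ?B) = card (?N ?B)"
      by (rule card_image) (rule inj_on_subset[OF bij_is_inj[OF bij_reflection]], simp)
    also have "card (?N A - {\<alpha>}) < card (?N A)"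
      using finite_pos \<alpha> simple_pos by (intro card_Diff1_less) auto
    finally obtain w where "w \<in> weyl_group \<Phi>" "(?B \<circ> w) ` \<Delta> = \<Delta>"
      using less.hyps B by blast
    thus ?thesis using weyl_comp[OF s] by (metis comp_assoc)
  qed
qed

text \<open>
  If \<open>word \<alpha>s\<close> makes \<open>\<alpha>\<close> negative, then at some letter \<open>\<gamma>\<close> the image of \<open>\<alpha>\<close> turns from positive to
  negative, so it is \<open>\<gamma>\<close> at that moment, and this letter cancels against \<open>reflection \<alpha>\<close>.
\<close>

lemma exchange_condition:
  assumes "set \<alpha>s \<subseteq> \<Delta>" "\<alpha> \<in> \<Delta>" "word \<alpha>s \<alpha> \<notin> pos"
  shows "\<exists>\<beta>s. set \<beta>s \<subseteq> \<Delta> \<and> length \<beta>s < length \<alpha>s \<and> (\<forall>v. word \<alpha>s (reflection \<alpha> v) = word \<beta>s v)"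
  using assms
proof (induction \<alpha>s)
  case Nil
  thus ?case using simple_pos by simp
next
  case (Cons \<gamma> \<gamma>s)
  have \<gamma>: "\<gamma> \<in> \<Delta>" "set \<gamma>s \<subseteq> \<Delta>" using Cons.prems by auto
  show ?case
  proof (cases "word \<gamma>s \<alpha> \<in> pos")
    case False
    then obtain \<beta>s where "set \<beta>s \<subseteq> \<Delta>" "length \<beta>s < length \<gamma>s" "\<forall>v. word \<gamma>s (reflection \<alpha> v) = word \<beta>s v"
      using Cons by auto
    thus ?thesis using \<gamma> by (intro exI[of _ "\<gamma> # \<beta>s"]) auto
  next
    case True
    hence eq: "word \<gamma>s \<alpha> = \<gamma>" using Cons.prems(3) simple_reflection_permutes_pos[OF \<gamma>(1)] by auto
    have "reflection \<gamma> (word \<gamma>s (reflection \<alpha> v)) = word \<gamma>s v" for v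
      using reflection_isometry[OF linear_word word_inner, of \<gamma>s \<alpha> "reflection \<alpha> v"]
      by (simp add: eq)
    thus ?thesis using \<gamma> by (intro exI[of _ \<gamma>s]) auto
  qed
qed

text \<open>
  In a shortest nonempty word for \<open>w\<close> with last letter \<open>\<alpha>\<close>, positivity of \<open>w \<alpha>\<close> would allow a
  shortening by the exchange condition.
\<close>

lemma weyl_eq_id_if_simple_pos:
  assumes w: "w \<in> weyl_group \<Phi>" and pos: "w ` \<Delta> \<subseteq> pos"
  shows "w = id"
proof -
  obtain \<alpha>s where "set \<alpha>s \<subseteq> \<Delta> \<and> w = word \<alpha>s" using weyl_groupE[OF w] by blast
  then obtain \<alpha>s where \<alpha>s: "set \<alpha>s \<subseteq> \<Delta> \<and> w = word \<alpha>s"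
    and minimal: "\<And>\<beta>s. set \<beta>s \<subseteq> \<Delta> \<and> w = word \<beta>s \<Longrightarrow> length \<alpha>s \<le> length \<beta>s"
    using ex_has_least_nat[of "\<lambda>\<alpha>s. set \<alpha>s \<subseteq> \<Delta> \<and> w = word \<alpha>s" \<alpha>s length] by blast
  show ?thesis
  proof (cases \<alpha>s rule: rev_cases)
    case (snoc \<gamma>s \<alpha>)
    hence \<alpha>: "\<alpha> \<in> \<Delta>" "set \<gamma>s \<subseteq> \<Delta>" and w_eq: "w = word \<gamma>s \<circ> reflection \<alpha>"
      using \<alpha>s by (auto simp: word_append fun_eq_iff)
    have "w \<alpha> = - word \<gamma>s \<alpha>"
      by (simp add: w_eq reflection_self linear_neg[OF linear_word])
    hence "word \<gamma>s \<alpha> \<notin> pos" using pos \<alpha>(1) uminus_not_pos[of "word \<gamma>s \<alpha>"] by auto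
    then obtain \<beta>s where "set \<beta>s \<subseteq> \<Delta>" "length \<beta>s < length \<gamma>s" "w = word \<beta>s"
      using exchange_condition[OF \<alpha>(2,1)] unfolding w_eq by (auto simp: fun_eq_iff)
    thus ?thesis using minimal[of \<beta>s] snoc by simp
  qed (use \<alpha>s in \<open>simp add: word_Nil\<close>)
qed

end

section \<open>Diagram automorphisms\<close>

lemma nat_pair_eq_if_small_product:
  fixes a b a' b' :: nat
  assumes "a * b = a' * b'" "a * b < 4" "b < a \<longleftrightarrow> b' < a'" "a < b \<longleftrightarrow> a' < b'"
    and "a = 0 \<longleftrightarrow> b = 0" "a' = 0 \<longleftrightarrow> b' = 0"
  shows "a = a'"
proof (cases "a = 0")
  case False
  have "a \<le> 3 \<and> b \<le> 3" "a' \<le> 3 \<and> b' \<le> 3"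
  proof -
    have *: "c \<le> 3" if "c * d < 4" "d \<noteq> 0" for c d :: nat
      using that by (cases d) auto
    show "a \<le> 3 \<and> b \<le> 3"
      using *[of a b] *[of b a] assms False by (simp add: mult.commute)
    have "a' \<noteq> 0" "b' \<noteq> 0" using assms False by (metis mult_is_0)+
    thus "a' \<le> 3 \<and> b' \<le> 3"
      using *[of a' b'] *[of b' a'] assms by (simp add: mult.commute)
  qed
  hence "a \<in> {1,2,3}" "b \<in> {1,2,3}" "a' \<in> {1,2,3}" "b' \<in> {1,2,3}"
    using False assms by auto
  thus ?thesis using assms(1-4) by auto
qed (use assms in auto)

text \<open>
  An edge of multiplicity less than four together with its arrow determines the Cartan integers.
\<close>

lemma real_pair_eq_if_small_product:
  fixes c d c' d' :: real
  assumes int: "c \<in> \<int>" "d \<in> \<int>" "c' \<in> \<int>" "d' \<in> \<int>"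
    and nonpos: "c \<le> 0" "d \<le> 0" "c' \<le> 0" "d' \<le> 0"
    and prod: "c * d = c' * d'" "c * d < 4"
    and less: "\<bar>d\<bar> < \<bar>c\<bar> \<longleftrightarrow> \<bar>d'\<bar> < \<bar>c'\<bar>" "\<bar>c\<bar> < \<bar>d\<bar> \<longleftrightarrow> \<bar>c'\<bar> < \<bar>d'\<bar>"
    and zero: "c = 0 \<longleftrightarrow> d = 0" "c' = 0 \<longleftrightarrow> d' = 0"
  shows "c = c'"
proof -
  have ex: "\<exists>n. x = - real n" if "x \<in> \<int>" "x \<le> 0" for x :: real
  proof -
    obtain z where "x = of_int z" using \<open>x \<in> \<int>\<close> by (rule Ints_cases)
    thus ?thesis using \<open>x \<le> 0\<close> by (intro exI[of _ "nat (- z)"]) simp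
  qed
  obtain a b a' b' where ab: "c = - real a" "d = - real b" "c' = - real a'" "d' = - real b'"
    using ex int nonpos by metis
  have "real (a * b) = real (a' * b')" "real (a * b) < real 4"
    using prod ab by simp_all
  hence "a * b = a' * b'" "a * b < 4" by (simp_all only: of_nat_eq_iff of_nat_less_iff)
  hence "a = a'"
    using less zero ab by (intro nat_pair_eq_if_small_product[of a b a' b']) auto
  thus ?thesis using ab by simp
qed

lemma diagram_auts_carrier:
  "\<sigma> \<in> carrier (diagram_auts D) \<longleftrightarrow> \<sigma> \<in> Bij (nodes D) \<and> (\<forall>\<alpha>\<in>nodes D. \<forall>\<beta>\<in>nodes D.
     edge_label D (\<sigma> \<alpha>) (\<sigma> \<beta>) = edge_label D \<alpha> \<beta> \<and> (arrow D (\<sigma> \<alpha>) (\<sigma> \<beta>) \<longleftrightarrow> arrow D \<alpha> \<beta>))"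
  by (simp add: diagram_auts_def)

lemma diagram_auts_mult:
  "\<sigma> \<in> Bij (nodes D) \<Longrightarrow> \<tau> \<in> Bij (nodes D) \<Longrightarrow> \<sigma> \<otimes>\<^bsub>diagram_auts D\<^esub> \<tau> = compose (nodes D) \<sigma> \<tau>"
  by (simp add: diagram_auts_def BijGroup_def)

lemma diagram_auts_one: "\<one>\<^bsub>diagram_auts D\<^esub> = (\<lambda>x\<in>nodes D. x)"
  by (simp add: diagram_auts_def BijGroup_def)

lemma group_diagram_auts: "group (diagram_auts D)"
proof -
  interpret B: group "BijGroup (nodes D)" by (rule group_BijGroup)
  let ?C = "carrier (diagram_auts D)"
  have "subgroup ?C (BijGroup (nodes D))"
  proof (rule B.subgroupI)
    show "?C \<subseteq> carrier (BijGroup (nodes D))"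
      by (auto simp: diagram_auts_carrier BijGroup_def)
    show "?C \<noteq> {}"
    proof -
      have "(\<lambda>x\<in>nodes D. x) \<in> ?C" by (simp add: diagram_auts_carrier id_Bij)
      thus ?thesis by blast
    qed
    fix \<sigma> assume \<sigma>: "\<sigma> \<in> ?C"
    hence Bij: "\<sigma> \<in> Bij (nodes D)" by (simp add: diagram_auts_carrier)
    let ?\<tau> = "inv_into (nodes D) \<sigma>"
    have \<tau>: "?\<tau> \<alpha> \<in> nodes D" "\<sigma> (?\<tau> \<alpha>) = \<alpha>" if "\<alpha> \<in> nodes D" for \<alpha>
      using Bij that by (auto simp: Bij_def bij_betw_def inv_into_into f_inv_into_f)
    have "edge_label D (?\<tau> \<alpha>) (?\<tau> \<beta>) = edge_label D \<alpha> \<beta>"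
      "arrow D (?\<tau> \<alpha>) (?\<tau> \<beta>) \<longleftrightarrow> arrow D \<alpha> \<beta>" if "\<alpha> \<in> nodes D" "\<beta> \<in> nodes D" for \<alpha> \<beta>
      using \<sigma> \<tau>[OF that(1)] \<tau>[OF that(2)] unfolding diagram_auts_carrier by metis+
    thus "inv\<^bsub>BijGroup (nodes D)\<^esub> \<sigma> \<in> ?C"
      using restrict_inv_into_Bij[OF Bij] by (simp add: inv_BijGroup[OF Bij] diagram_auts_carrier)
  next
    fix \<sigma> \<tau> assume *: "\<sigma> \<in> ?C" "\<tau> \<in> ?C"
    hence Bij: "\<sigma> \<in> Bij (nodes D)" "\<tau> \<in> Bij (nodes D)" by (simp_all add: diagram_auts_carrier)
    have "\<tau> \<alpha> \<in> nodes D" if "\<alpha> \<in> nodes D" for \<alpha>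
      using Bij(2) that by (auto dest: Bij_imp_funcset)
    thus "\<sigma> \<otimes>\<^bsub>BijGroup (nodes D)\<^esub> \<tau> \<in> ?C"
      using * Bij compose_Bij[OF Bij]
      by (simp add: BijGroup_def diagram_auts_carrier compose_def)
  qed
  from B.subgroup_imp_group[OF this] show ?thesis by (simp add: diagram_auts_def)
qed

context based_root_system
begin

text \<open>
  Equality in the Cauchy-Schwarz inequality forces proportional vectors, and proportional roots of
  a reduced root system are equal or opposite.
\<close>

lemma cartan_int_product_less_4:
  assumes \<alpha>: "\<alpha> \<in> \<Phi>" and \<beta>: "\<beta> \<in> \<Phi>" and ne: "\<alpha> \<noteq> \<beta>" "\<alpha> \<noteq> - \<beta>"
  shows "cartan_int \<alpha> \<beta> * cartan_int \<beta> \<alpha> < 4"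
proof (rule ccontr)
  assume neg: "\<not> ?thesis"
  have p: "0 < \<alpha> \<bullet> \<alpha>" "0 < \<beta> \<bullet> \<beta>" using root_nonzero[OF \<alpha>] root_nonzero[OF \<beta>] by auto
  define c where "c = (\<alpha> \<bullet> \<beta>) / (\<beta> \<bullet> \<beta>)"
  have "(\<alpha> \<bullet> \<alpha>) * (\<beta> \<bullet> \<beta>) \<le> (\<alpha> \<bullet> \<beta>) * (\<alpha> \<bullet> \<beta>)"
    using neg p by (simp add: cartan_int_def inner_commute field_simps)
  moreover have "(\<alpha> - c *\<^sub>R \<beta>) \<bullet> (\<alpha> - c *\<^sub>R \<beta>) = \<alpha> \<bullet> \<alpha> - (\<alpha> \<bullet> \<beta>) * (\<alpha> \<bullet> \<beta>) / (\<beta> \<bullet> \<beta>)"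
    using p by (simp add: c_def inner_diff_left inner_diff_right inner_commute)
  moreover have "\<alpha> \<bullet> \<alpha> \<le> (\<alpha> \<bullet> \<beta>) * (\<alpha> \<bullet> \<beta>) / (\<beta> \<bullet> \<beta>)"
    using calculation(1) p(2) by (simp add: pos_le_divide_eq)
  ultimately have "(\<alpha> - c *\<^sub>R \<beta>) \<bullet> (\<alpha> - c *\<^sub>R \<beta>) \<le> 0" by linarith
  hence "(\<alpha> - c *\<^sub>R \<beta>) \<bullet> (\<alpha> - c *\<^sub>R \<beta>) = 0" by (intro antisym inner_ge_zero)
  hence "\<alpha> = c *\<^sub>R \<beta>" by (simp only: inner_eq_zero_iff right_minus_eq)
  moreover from this have "c = 1 \<or> c = -1" using reduced[OF \<beta>, of c] \<alpha> by simp
  ultimately show False using ne by auto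
qed

text \<open>
  Opposite roots carry the label \<open>\<infinity>\<close>; this case is also visible in the Cartan integers.
\<close>

lemma opposite_iff_cartan_int:
  assumes "\<alpha> \<in> \<Phi>" "\<beta> \<in> \<Phi>"
  shows "\<alpha> = - \<beta> \<longleftrightarrow> cartan_int \<alpha> \<beta> = -2 \<and> cartan_int \<beta> \<alpha> = -2"
proof
  assume "\<alpha> = - \<beta>"
  thus "cartan_int \<alpha> \<beta> = -2 \<and> cartan_int \<beta> \<alpha> = -2"
    using root_nonzero[OF assms(2)] by (simp add: cartan_int_minus_left cartan_int_minus_right)
next
  assume *: "cartan_int \<alpha> \<beta> = -2 \<and> cartan_int \<beta> \<alpha> = -2"
  hence "\<alpha> \<noteq> \<beta>" using root_nonzero[OF assms(1)] by auto
  thus "\<alpha> = - \<beta>" using cartan_int_product_less_4[OF assms] * by auto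
qed

lemma dynkin_diagram_simps:
  "nodes (dynkin_diagram S) = S"
  "edge_label (dynkin_diagram S) \<alpha> \<beta> = (if \<alpha> = \<beta> then 0 else if \<alpha> = - \<beta> then \<infinity>
     else enat (nat \<lfloor>cartan_int \<alpha> \<beta> * cartan_int \<beta> \<alpha>\<rfloor>))"
  "arrow (dynkin_diagram S) \<alpha> \<beta> \<longleftrightarrow> \<alpha> \<bullet> \<beta> \<noteq> 0 \<and> norm \<alpha> > norm \<beta>"
  by (simp_all add: dynkin_diagram_def)

lemma dynkin_aut_iff_cartan_int:
  assumes S: "S \<subseteq> \<Phi>"
    and obtuse: "\<And>\<alpha> \<beta>. \<alpha> \<in> S \<Longrightarrow> \<beta> \<in> S \<Longrightarrow> \<alpha> \<noteq> \<beta> \<Longrightarrow> \<alpha> \<bullet> \<beta> \<le> 0"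
  shows "\<sigma> \<in> carrier (diagram_auts (dynkin_diagram S)) \<longleftrightarrow>
    \<sigma> \<in> Bij S \<and> (\<forall>\<alpha>\<in>S. \<forall>\<beta>\<in>S. cartan_int (\<sigma> \<alpha>) (\<sigma> \<beta>) = cartan_int \<alpha> \<beta>)"
    (is "_ \<longleftrightarrow> _ \<and> ?cartan")
proof -
  have "(\<forall>\<alpha>\<in>S. \<forall>\<beta>\<in>S.
       edge_label (dynkin_diagram S) (\<sigma> \<alpha>) (\<sigma> \<beta>) = edge_label (dynkin_diagram S) \<alpha> \<beta> \<and>
       (arrow (dynkin_diagram S) (\<sigma> \<alpha>) (\<sigma> \<beta>) \<longleftrightarrow> arrow (dynkin_diagram S) \<alpha> \<beta>)) \<longleftrightarrow> ?cartan"
    (is "?diagram \<longleftrightarrow> _") if Bij: "\<sigma> \<in> Bij S"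
  proof -
    have \<sigma>S: "\<sigma> \<alpha> \<in> S" if "\<alpha> \<in> S" for \<alpha> using Bij that by (auto dest: Bij_imp_funcset)
    have inj: "\<sigma> \<alpha> = \<sigma> \<beta> \<longleftrightarrow> \<alpha> = \<beta>" if "\<alpha> \<in> S" "\<beta> \<in> S" for \<alpha> \<beta>
      using Bij that by (auto simp: Bij_def bij_betw_def inj_on_eq_iff)
    have \<Phi>: "\<alpha> \<in> \<Phi>" "\<sigma> \<alpha> \<in> \<Phi>" "\<alpha> \<noteq> 0" "\<sigma> \<alpha> \<noteq> 0" if "\<alpha> \<in> S" for \<alpha>
      using S that \<sigma>S[OF that] root_nonzero by blast+
    show "?diagram \<longleftrightarrow> ?cartan"
    proof
      assume c: ?cartan
      show ?diagram
      proof (intro ballI)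
        fix \<alpha> \<beta> assume \<alpha>\<beta>: "\<alpha> \<in> S" "\<beta> \<in> S"
        have "\<sigma> \<alpha> = - \<sigma> \<beta> \<longleftrightarrow> \<alpha> = - \<beta>"
          using c \<alpha>\<beta> \<Phi> by (simp add: opposite_iff_cartan_int)
        moreover have "arrow (dynkin_diagram S) (\<sigma> \<alpha>) (\<sigma> \<beta>) \<longleftrightarrow> arrow (dynkin_diagram S) \<alpha> \<beta>"
          unfolding dynkin_diagram_simps
          using c \<alpha>\<beta> \<Phi>[OF \<alpha>\<beta>(1)] \<Phi>[OF \<alpha>\<beta>(2)]
            arrow_iff_cartan_int[of \<alpha> \<beta>] arrow_iff_cartan_int[of "\<sigma> \<alpha>" "\<sigma> \<beta>"] by simp
        ultimately show "edge_label (dynkin_diagram S) (\<sigma> \<alpha>) (\<sigma> \<beta>) = edge_label (dynkin_diagram S) \<alpha> \<beta> \<and>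
            (arrow (dynkin_diagram S) (\<sigma> \<alpha>) (\<sigma> \<beta>) \<longleftrightarrow> arrow (dynkin_diagram S) \<alpha> \<beta>)"
          using c \<alpha>\<beta> inj by (simp add: dynkin_diagram_simps(2))
      qed
    next
      assume d: ?diagram
      show ?cartan
      proof (intro ballI)
        fix \<alpha> \<beta> assume \<alpha>\<beta>: "\<alpha> \<in> S" "\<beta> \<in> S"
        note r = \<Phi>[OF \<alpha>\<beta>(1)] \<Phi>[OF \<alpha>\<beta>(2)]
        have label: "edge_label (dynkin_diagram S) (\<sigma> \<alpha>) (\<sigma> \<beta>) = edge_label (dynkin_diagram S) \<alpha> \<beta>"
          using d \<alpha>\<beta> by blast
        have arrow: "arrow (dynkin_diagram S) (\<sigma> \<gamma>) (\<sigma> \<delta>) \<longleftrightarrow> arrow (dynkin_diagram S) \<gamma> \<delta>"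
          if "\<gamma> \<in> S" "\<delta> \<in> S" for \<gamma> \<delta> using d that by blast
        consider "\<alpha> = \<beta>" | "\<alpha> \<noteq> \<beta>" "\<alpha> = - \<beta>" | "\<alpha> \<noteq> \<beta>" "\<alpha> \<noteq> - \<beta>" by blast
        thus "cartan_int (\<sigma> \<alpha>) (\<sigma> \<beta>) = cartan_int \<alpha> \<beta>"
        proof cases
          case 1
          thus ?thesis using r by simp
        next
          case 2
          hence "\<sigma> \<alpha> = - \<sigma> \<beta>"
            using label inj[OF \<alpha>\<beta>] by (auto simp: dynkin_diagram_simps split: if_splits)
          thus ?thesis using 2 r by (simp add: cartan_int_minus_left)
        next
          case 3
          hence ne': "\<sigma> \<alpha> \<noteq> \<sigma> \<beta>" "\<sigma> \<alpha> \<noteq> - \<sigma> \<beta>"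
            using label inj[OF \<alpha>\<beta>] by (auto simp: dynkin_diagram_simps split: if_splits)
          have ints: "cartan_int \<alpha> \<beta> \<in> \<int>" "cartan_int \<beta> \<alpha> \<in> \<int>"
            "cartan_int (\<sigma> \<alpha>) (\<sigma> \<beta>) \<in> \<int>" "cartan_int (\<sigma> \<beta>) (\<sigma> \<alpha>) \<in> \<int>"
            using r cartan_int_Ints by blast+
          have nonpos: "cartan_int \<alpha> \<beta> \<le> 0" "cartan_int \<beta> \<alpha> \<le> 0"
            "cartan_int (\<sigma> \<alpha>) (\<sigma> \<beta>) \<le> 0" "cartan_int (\<sigma> \<beta>) (\<sigma> \<alpha>) \<le> 0"
            using obtuse[OF \<alpha>\<beta> 3(1)] obtuse[OF \<sigma>S[OF \<alpha>\<beta>(1)] \<sigma>S[OF \<alpha>\<beta>(2)] ne'(1)]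
            by (auto simp: cartan_int_def inner_commute divide_nonpos_nonneg)
          have "nat \<lfloor>cartan_int \<alpha> \<beta> * cartan_int \<beta> \<alpha>\<rfloor>
              = nat \<lfloor>cartan_int (\<sigma> \<alpha>) (\<sigma> \<beta>) * cartan_int (\<sigma> \<beta>) (\<sigma> \<alpha>)\<rfloor>"
            using label 3 ne' by (simp add: dynkin_diagram_simps)
          moreover have "0 \<le> cartan_int \<alpha> \<beta> * cartan_int \<beta> \<alpha>"
            "0 \<le> cartan_int (\<sigma> \<alpha>) (\<sigma> \<beta>) * cartan_int (\<sigma> \<beta>) (\<sigma> \<alpha>)"
            using nonpos by (simp_all add: mult_nonpos_nonpos)
          moreover have "cartan_int \<alpha> \<beta> * cartan_int \<beta> \<alpha> \<in> \<int>"
            "cartan_int (\<sigma> \<alpha>) (\<sigma> \<beta>) * cartan_int (\<sigma> \<beta>) (\<sigma> \<alpha>) \<in> \<int>"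
            using ints by auto
          ultimately have prod: "cartan_int \<alpha> \<beta> * cartan_int \<beta> \<alpha>
              = cartan_int (\<sigma> \<alpha>) (\<sigma> \<beta>) * cartan_int (\<sigma> \<beta>) (\<sigma> \<alpha>)"
            by (auto elim!: Ints_cases)
          have "\<bar>cartan_int \<delta> \<gamma>\<bar> < \<bar>cartan_int \<gamma> \<delta>\<bar> \<longleftrightarrow>
              \<bar>cartan_int (\<sigma> \<delta>) (\<sigma> \<gamma>)\<bar> < \<bar>cartan_int (\<sigma> \<gamma>) (\<sigma> \<delta>)\<bar>"
            if "\<gamma> \<in> S" "\<delta> \<in> S" for \<gamma> \<delta>
            using arrow[OF that] \<Phi>[OF that(1)] \<Phi>[OF that(2)]
              arrow_iff_cartan_int[of \<gamma> \<delta>] arrow_iff_cartan_int[of "\<sigma> \<gamma>" "\<sigma> \<delta>"]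
            unfolding dynkin_diagram_simps by simp
          note less = this[OF \<alpha>\<beta>] this[OF \<alpha>\<beta>(2,1)]
          have zero: "cartan_int \<gamma> \<delta> = 0 \<longleftrightarrow> cartan_int \<delta> \<gamma> = 0" if "\<gamma> \<noteq> 0" "\<delta> \<noteq> 0" for \<gamma> \<delta> :: 'a
            using that by (auto simp: cartan_int_def inner_commute)
          have "cartan_int \<alpha> \<beta> = cartan_int (\<sigma> \<alpha>) (\<sigma> \<beta>)"
            by (rule real_pair_eq_if_small_product[OF ints nonpos prod
                  cartan_int_product_less_4[OF r(1,5) 3] less])
              (rule zero; use r in simp)+
          thus ?thesis by simp
        qed
      qed
    qed
  qed
  thus ?thesis by (auto simp: diagram_auts_carrier dynkin_diagram_simps(1))
qed

end

lemma restrict_Bij: "bij A \<Longrightarrow> A ` S = S \<Longrightarrow> restrict A S \<in> Bij S"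
  by (auto simp: Bij_def bij_betw_def bij_def inj_on_def)

lemma compose_restrict: "B ` S = S \<Longrightarrow> compose S (restrict A S) (restrict B S) = restrict (A \<circ> B) S"
  by (auto simp: compose_def fun_eq_iff)

section \<open>The highest root\<close>

locale highest_root_system = based_root_system +
  fixes \<alpha>\<^sub>0 :: 'a
  assumes highest_root: "highest_root \<Phi> \<Delta> \<alpha>\<^sub>0"
begin

lemma highest_is_root: "\<alpha>\<^sub>0 \<in> \<Phi>"
  using highest_root by (simp add: highest_root_def)

lemma coeff_le_highest: "\<beta> \<in> \<Phi> \<Longrightarrow> \<alpha> \<in> \<Delta> \<Longrightarrow> coeff \<alpha> \<beta> \<le> coeff \<alpha> \<alpha>\<^sub>0"
proof -
  assume *: "\<beta> \<in> \<Phi>" "\<alpha> \<in> \<Delta>"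
  obtain c :: "'a \<Rightarrow> nat" where "\<alpha>\<^sub>0 - \<beta> = (\<Sum>\<alpha>\<in>\<Delta>. of_nat (c \<alpha>) *\<^sub>R \<alpha>)"
    using highest_root * unfolding highest_root_def by blast
  hence "coeff \<alpha> (\<alpha>\<^sub>0 - \<beta>) = of_nat (c \<alpha>)" using coeff_sum[OF *(2)] by simp
  thus ?thesis by (simp add: blinfun.diff_right)
qed

lemma coeff_highest_ge_1: "\<alpha> \<in> \<Delta> \<Longrightarrow> coeff \<alpha> \<alpha>\<^sub>0 \<ge> 1"
  using coeff_le_highest[of \<alpha> \<alpha>] simple_root by (simp add: coeff_simple)

lemma highest_pos: "\<alpha>\<^sub>0 \<in> pos"
  using coeff_highest_ge_1 highest_is_root by (force simp: pos_def)

lemma ht_le_highest: "\<beta> \<in> \<Phi> \<Longrightarrow> ht \<beta> \<le> ht \<alpha>\<^sub>0"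
  unfolding ht_eq by (intro sum_mono coeff_le_highest)

lemma eq_highest_if_ht_ge:
  assumes "\<beta> \<in> \<Phi>" "ht \<beta> \<ge> ht \<alpha>\<^sub>0" shows "\<beta> = \<alpha>\<^sub>0"
proof (rule coeff_eq_imp_eq)
  fix \<alpha> assume "\<alpha> \<in> \<Delta>"
  have "(\<Sum>\<alpha>\<in>\<Delta>. coeff \<alpha> \<alpha>\<^sub>0 - coeff \<alpha> \<beta>) = 0"
    using assms ht_le_highest[of \<beta>] by (simp add: sum_subtractf ht_eq)
  hence "coeff \<alpha> \<alpha>\<^sub>0 - coeff \<alpha> \<beta> = 0"
    using \<open>\<alpha> \<in> \<Delta>\<close> coeff_le_highest[OF assms(1)] finite_simple
    by (subst (asm) sum_nonneg_eq_0_iff) auto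
  thus "coeff \<alpha> \<beta> = coeff \<alpha> \<alpha>\<^sub>0" by simp
qed

lemma minus_highest_not_simple: "- \<alpha>\<^sub>0 \<notin> \<Delta>"
  using uminus_not_pos[OF highest_pos] simple_pos by blast

text \<open>
  The nodes of the extended Dynkin diagram.
\<close>

abbreviation ext_nodes :: "'a set" ("\<Delta>\<^sub>e") where
  "\<Delta>\<^sub>e \<equiv> insert (- \<alpha>\<^sub>0) \<Delta>"

lemma ext_node_root: "\<beta> \<in> \<Delta>\<^sub>e \<Longrightarrow> \<beta> \<in> \<Phi>"
  using simple_root uminus_root[OF highest_is_root] by auto

lemma finite_ext_nodes: "finite \<Delta>\<^sub>e"
  using finite_simple by simp

lemma ext_nodes_inner_nonpos:
  assumes "\<alpha> \<in> \<Delta>\<^sub>e" "\<beta> \<in> \<Delta>\<^sub>e" "\<alpha> \<noteq> \<beta>" shows "\<alpha> \<bullet> \<beta> \<le> 0"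
proof -
  \<comment> \<open>Otherwise the reflection in \<open>\<gamma>\<close> would send \<open>\<alpha>\<^sub>0\<close> to a higher root.\<close>
  have *: "\<alpha>\<^sub>0 \<bullet> \<gamma> \<ge> 0" if "\<gamma> \<in> \<Delta>" for \<gamma>
  proof (rule ccontr)
    assume "\<not> \<alpha>\<^sub>0 \<bullet> \<gamma> \<ge> 0"
    hence "cartan_int \<alpha>\<^sub>0 \<gamma> < 0"
      using root_nonzero[OF simple_root[OF that]]
      by (simp add: cartan_int_def divide_neg_pos)
    moreover have "coeff \<gamma> (reflection \<gamma> \<alpha>\<^sub>0) \<le> coeff \<gamma> \<alpha>\<^sub>0"
      using that highest_is_root simple_root by (intro coeff_le_highest reflection_root)
    ultimately show False
      using that by (simp add: reflection_cartan_int blinfun.diff_right blinfun.scaleR_right coeff_simple)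
  qed
  consider "\<alpha> = - \<alpha>\<^sub>0" "\<beta> \<in> \<Delta>" | "\<alpha> \<in> \<Delta>" "\<beta> = - \<alpha>\<^sub>0" | "\<alpha> \<in> \<Delta>" "\<beta> \<in> \<Delta>"
    using assms by blast
  thus ?thesis
  proof cases
    case 1
    thus ?thesis using *[of \<beta>] by simp
  next
    case 2
    thus ?thesis using *[of \<alpha>] by (simp add: inner_commute)
  next
    case 3
    thus ?thesis using simple_inner_nonpos assms(3) by blast
  qed
qed

text \<open>
  The coefficients of the linear relation between the extended nodes, normalized to \<open>1\<close> at
  \<open>- \<alpha>\<^sub>0\<close>; at a simple root the mark is the coefficient of the highest root.
\<close>

definition mark :: "'a \<Rightarrow> real" where
  "mark \<beta> = (if \<beta> = - \<alpha>\<^sub>0 then 1 else coeff \<beta> \<alpha>\<^sub>0)"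

lemma mark_minus_highest [simp]: "mark (- \<alpha>\<^sub>0) = 1"
  by (simp add: mark_def)

lemma mark_simple: "\<beta> \<in> \<Delta> \<Longrightarrow> mark \<beta> = coeff \<beta> \<alpha>\<^sub>0"
  using minus_highest_not_simple by (auto simp: mark_def)

lemma mark_ge_1: "\<beta> \<in> \<Delta>\<^sub>e \<Longrightarrow> mark \<beta> \<ge> 1"
  using coeff_highest_ge_1 by (auto simp: mark_def)

lemma sum_ext_nodes: "(\<Sum>\<beta>\<in>\<Delta>\<^sub>e. f \<beta>) = f (- \<alpha>\<^sub>0) + (\<Sum>\<beta>\<in>\<Delta>. f \<beta>)"
  using minus_highest_not_simple finite_simple by simp

lemma sum_marks_linear:
  assumes "linear f" shows "(\<Sum>\<beta>\<in>\<Delta>\<^sub>e. mark \<beta> *\<^sub>R f \<beta>) = 0"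
proof -
  have "(\<Sum>\<beta>\<in>\<Delta>. mark \<beta> *\<^sub>R f \<beta>) = f \<alpha>\<^sub>0"
    using linear_expansion[OF assms, of \<alpha>\<^sub>0] by (simp add: mark_simple)
  thus ?thesis by (simp add: sum_ext_nodes linear_neg[OF assms] del: sum.insert)
qed

lemma ext_relation_unique:
  assumes "(\<Sum>\<beta>\<in>\<Delta>\<^sub>e. n \<beta> *\<^sub>R \<beta>) = 0" "\<beta> \<in> \<Delta>\<^sub>e"
  shows "n \<beta> = n (- \<alpha>\<^sub>0) * mark \<beta>"
proof (cases "\<beta> = - \<alpha>\<^sub>0")
  case False
  hence \<beta>: "\<beta> \<in> \<Delta>" using assms(2) by simp
  have "(\<Sum>\<beta>\<in>\<Delta>. n \<beta> *\<^sub>R \<beta>) = n (- \<alpha>\<^sub>0) *\<^sub>R \<alpha>\<^sub>0"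
    using assms(1) unfolding sum_ext_nodes by (simp add: add_eq_0_iff)
  from arg_cong[OF this, of "coeff \<beta>"] show ?thesis
    using \<beta> by (simp add: coeff_sum mark_simple blinfun.scaleR_right)
qed simp

text \<open>
  The map \<open>A\<close> carries the relation with coefficients \<open>mark \<circ> A\<close> to the relation with coefficients
  \<open>mark\<close>; so \<open>mark \<circ> A\<close> is a multiple of \<open>mark\<close>, and both have the same sum over the nodes.
\<close>

lemma mark_root_aut:
  assumes A: "A \<in> root_auts" and img: "A ` \<Delta>\<^sub>e = \<Delta>\<^sub>e" and \<beta>: "\<beta> \<in> \<Delta>\<^sub>e"
  shows "mark (A \<beta>) = mark \<beta>"
proof -
  have inj: "inj_on A \<Delta>\<^sub>e" using root_aut_bij[OF A] by (auto simp: bij_def inj_on_def)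
  have reindex: "(\<Sum>\<gamma>\<in>\<Delta>\<^sub>e. f (A \<gamma>)) = (\<Sum>\<gamma>\<in>\<Delta>\<^sub>e. f \<gamma>)" for f :: "'a \<Rightarrow> 'b::comm_monoid_add"
    using sum.reindex[OF inj, of f] unfolding img by (simp add: o_def)
  have "A (\<Sum>\<gamma>\<in>\<Delta>\<^sub>e. mark (A \<gamma>) *\<^sub>R \<gamma>) = (\<Sum>\<gamma>\<in>\<Delta>\<^sub>e. mark (A \<gamma>) *\<^sub>R A \<gamma>)"
    using root_aut_linear[OF A] by (simp only: linear_sum linear_scale)
  also have "\<dots> = (\<Sum>\<gamma>\<in>\<Delta>\<^sub>e. mark \<gamma> *\<^sub>R \<gamma>)" by (rule reindex)
  also have "\<dots> = 0" using sum_marks_linear[OF linear_ident] by simp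
  finally have "(\<Sum>\<gamma>\<in>\<Delta>\<^sub>e. mark (A \<gamma>) *\<^sub>R \<gamma>) = 0"
    using root_aut_bij[OF A] linear_injective_0[OF root_aut_linear[OF A]] by (simp only: bij_def)
  note rel = ext_relation_unique[OF this]
  have "(\<Sum>\<gamma>\<in>\<Delta>\<^sub>e. mark \<gamma>) = (\<Sum>\<gamma>\<in>\<Delta>\<^sub>e. mark (A \<gamma>))" by (rule reindex[symmetric])
  also have "\<dots> = (\<Sum>\<gamma>\<in>\<Delta>\<^sub>e. mark (A (- \<alpha>\<^sub>0)) * mark \<gamma>)" by (rule sum.cong[OF refl]) (rule rel)
  also have "\<dots> = mark (A (- \<alpha>\<^sub>0)) * (\<Sum>\<gamma>\<in>\<Delta>\<^sub>e. mark \<gamma>)" by (rule sum_distrib_left[symmetric])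
  finally have "mark (A (- \<alpha>\<^sub>0)) = 1 \<or> (\<Sum>\<gamma>\<in>\<Delta>\<^sub>e. mark \<gamma>) = 0"
    by (metis mult_cancel_right1)
  moreover have "(\<Sum>\<gamma>\<in>\<Delta>\<^sub>e. mark \<gamma>) > 0"
    using mark_ge_1 finite_ext_nodes by (intro sum_pos) (auto intro: less_le_trans[OF zero_less_one])
  ultimately show ?thesis using rel[OF \<beta>] by simp
qed

section \<open>Diagram automorphisms as root system automorphisms\<close>

text \<open>
  The automorphism groups of the Dynkin diagram and of the extended Dynkin diagram.
\<close>

abbreviation "AutD \<equiv> diagram_auts (dynkin_diagram \<Delta>)"
abbreviation "AutE \<equiv> diagram_auts (extended_dynkin_diagram \<Delta> \<alpha>\<^sub>0)"

lemma ex_root_aut_extending: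
  assumes "\<And>\<alpha>. \<alpha> \<in> \<Delta> \<Longrightarrow> \<sigma> \<alpha> \<in> \<Phi>"
    and "\<And>\<alpha> \<beta>. \<alpha> \<in> \<Delta> \<Longrightarrow> \<beta> \<in> \<Delta> \<Longrightarrow> cartan_int (\<sigma> \<alpha>) (\<sigma> \<beta>) = cartan_int \<alpha> \<beta>"
  obtains A where "A \<in> root_auts" "\<And>\<alpha>. \<alpha> \<in> \<Delta> \<Longrightarrow> A \<alpha> = \<sigma> \<alpha>"
proof -
  obtain A where A: "linear A" "\<forall>\<alpha>\<in>\<Delta>. A \<alpha> = \<sigma> \<alpha>"
    using linear_independent_extend[OF independent_simple, of \<sigma>] by blast
  with assms have "A \<in> root_auts" by (intro root_autI) simp_all
  with A that show ?thesis by blast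
qed

lemma AutD_iff:
  "\<sigma> \<in> carrier AutD \<longleftrightarrow> \<sigma> \<in> Bij \<Delta> \<and> (\<forall>\<alpha>\<in>\<Delta>. \<forall>\<beta>\<in>\<Delta>. cartan_int (\<sigma> \<alpha>) (\<sigma> \<beta>) = cartan_int \<alpha> \<beta>)"
  using simple_roots simple_inner_nonpos by (rule dynkin_aut_iff_cartan_int)

lemma AutE_iff:
  "\<sigma> \<in> carrier AutE \<longleftrightarrow> \<sigma> \<in> Bij \<Delta>\<^sub>e \<and> (\<forall>\<alpha>\<in>\<Delta>\<^sub>e. \<forall>\<beta>\<in>\<Delta>\<^sub>e. cartan_int (\<sigma> \<alpha>) (\<sigma> \<beta>) = cartan_int \<alpha> \<beta>)"
  unfolding extended_dynkin_diagram_def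
  using ext_node_root ext_nodes_inner_nonpos by (intro dynkin_aut_iff_cartan_int) blast+

lemma AutD_carrier: "carrier AutD = (\<lambda>A. restrict A \<Delta>) ` {A \<in> root_auts. A ` \<Delta> = \<Delta>}"
proof (intro equalityI subsetI)
  fix \<sigma> assume "\<sigma> \<in> carrier AutD"
  hence \<sigma>: "\<sigma> \<in> Bij \<Delta>" "\<And>\<alpha> \<beta>. \<alpha> \<in> \<Delta> \<Longrightarrow> \<beta> \<in> \<Delta> \<Longrightarrow> cartan_int (\<sigma> \<alpha>) (\<sigma> \<beta>) = cartan_int \<alpha> \<beta>"
    by (simp_all add: AutD_iff)
  have img: "\<sigma> ` \<Delta> = \<Delta>" and ext: "\<sigma> \<in> extensional \<Delta>"
    using \<sigma>(1) by (auto simp: Bij_def bij_betw_def)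
  obtain A where A: "A \<in> root_auts" "\<And>\<alpha>. \<alpha> \<in> \<Delta> \<Longrightarrow> A \<alpha> = \<sigma> \<alpha>"
    using ex_root_aut_extending[of \<sigma>] \<sigma>(2) img simple_root by blast
  have "A ` \<Delta> = \<Delta>" using A(2) img by auto
  moreover have "\<sigma> = restrict A \<Delta>"
    using A(2) ext by (intro extensionalityI[of _ \<Delta>]) auto
  ultimately show "\<sigma> \<in> (\<lambda>A. restrict A \<Delta>) ` {A \<in> root_auts. A ` \<Delta> = \<Delta>}" using A(1) by blast
next
  fix \<sigma> assume "\<sigma> \<in> (\<lambda>A. restrict A \<Delta>) ` {A \<in> root_auts. A ` \<Delta> = \<Delta>}"
  then obtain A where A: "A \<in> root_auts" "A ` \<Delta> = \<Delta>" "\<sigma> = restrict A \<Delta>" by blast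
  thus "\<sigma> \<in> carrier AutD"
    using restrict_Bij[OF root_aut_bij[OF A(1)] A(2)]
    by (simp add: AutD_iff root_aut_cartan_int simple_root)
qed

lemma AutE_carrier: "carrier AutE = (\<lambda>A. restrict A \<Delta>\<^sub>e) ` {A \<in> root_auts. A ` \<Delta>\<^sub>e = \<Delta>\<^sub>e}"
proof (intro equalityI subsetI)
  fix \<sigma> assume "\<sigma> \<in> carrier AutE"
  note * = this[unfolded AutE_iff]
  have \<sigma>: "\<sigma> \<in> Bij \<Delta>\<^sub>e" "\<And>\<alpha> \<beta>. \<alpha> \<in> \<Delta>\<^sub>e \<Longrightarrow> \<beta> \<in> \<Delta>\<^sub>e \<Longrightarrow> cartan_int (\<sigma> \<alpha>) (\<sigma> \<beta>) = cartan_int \<alpha> \<beta>"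
    by (rule *[THEN conjunct1], rule *[THEN conjunct2, THEN bspec, THEN bspec])
  have img: "\<sigma> ` \<Delta>\<^sub>e = \<Delta>\<^sub>e" and ext: "\<sigma> \<in> extensional \<Delta>\<^sub>e"
    using \<sigma>(1) by (simp_all only: Bij_def bij_betw_def Int_iff mem_Collect_eq)
  have mem: "\<alpha> \<in> \<Delta>\<^sub>e" if "\<alpha> \<in> \<Delta>" for \<alpha> using that by (rule insertI2)
  have "\<sigma> \<alpha> \<in> \<Phi>" if "\<alpha> \<in> \<Delta>" for \<alpha>
    using imageI[OF mem[OF that], of \<sigma>] unfolding img by (rule ext_node_root)
  then obtain A where A: "A \<in> root_auts" "\<And>\<alpha>. \<alpha> \<in> \<Delta> \<Longrightarrow> A \<alpha> = \<sigma> \<alpha>"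
    using ex_root_aut_extending[of \<sigma>] \<sigma>(2)[OF mem mem] by metis
  \<comment> \<open>The image of the linear relation between the nodes is again a relation, since it is
    orthogonal to all nodes; hence \<open>A\<close> agrees with \<open>\<sigma>\<close> on \<open>- \<alpha>\<^sub>0\<close> too.\<close>
  define v where "v = (\<Sum>\<beta>\<in>\<Delta>\<^sub>e. mark \<beta> *\<^sub>R \<sigma> \<beta>)"
  have "v \<bullet> \<gamma> = 0" if \<gamma>: "\<gamma> \<in> \<Delta>\<^sub>e" for \<gamma>
  proof -
    have "\<gamma> \<in> \<sigma> ` \<Delta>\<^sub>e" using \<gamma> by (simp only: img)
    then obtain \<delta> where \<delta>: "\<delta> \<in> \<Delta>\<^sub>e" "\<gamma> = \<sigma> \<delta>" by blast
    have "cartan_int v \<gamma> = (\<Sum>\<beta>\<in>\<Delta>\<^sub>e. mark \<beta> *\<^sub>R cartan_int (\<sigma> \<beta>) (\<sigma> \<delta>))"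
      unfolding v_def \<delta>(2) by (simp only: linear_sum[OF linear_cartan_int] cartan_int_scaleR_left real_scaleR_def)
    also have "\<dots> = (\<Sum>\<beta>\<in>\<Delta>\<^sub>e. mark \<beta> *\<^sub>R cartan_int \<beta> \<delta>)"
      using \<sigma>(2) \<delta>(1) by (intro sum.cong) auto
    also have "\<dots> = 0" by (rule sum_marks_linear) (rule linear_cartan_int)
    finally show ?thesis
      using root_nonzero[OF ext_node_root[OF \<gamma>]] by (simp add: cartan_int_def)
  qed
  hence "v = 0" by (intro orthogonal_simple_eq_0) (simp only: mem)
  moreover have "v = \<sigma> (- \<alpha>\<^sub>0) + A \<alpha>\<^sub>0"
    unfolding v_def sum_ext_nodes linear_expansion[OF root_aut_linear[OF A(1)], of \<alpha>\<^sub>0]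
    by (simp add: A(2) mark_simple)
  ultimately have "A (- \<alpha>\<^sub>0) = \<sigma> (- \<alpha>\<^sub>0)"
    by (simp add: linear_neg[OF root_aut_linear[OF A(1)]] add_eq_0_iff)
  with A(2) have A': "\<And>\<beta>. \<beta> \<in> \<Delta>\<^sub>e \<Longrightarrow> A \<beta> = \<sigma> \<beta>" by (elim insertE) simp_all
  have "A ` \<Delta>\<^sub>e = \<sigma> ` \<Delta>\<^sub>e" by (rule image_cong[OF refl A'])
  hence "A ` \<Delta>\<^sub>e = \<Delta>\<^sub>e" unfolding img .
  moreover have "\<sigma> = restrict A \<Delta>\<^sub>e"
    by (rule extensionalityI[OF ext restrict_extensional]) (simp only: A' restrict_apply')
  ultimately show "\<sigma> \<in> (\<lambda>A. restrict A \<Delta>\<^sub>e) ` {A \<in> root_auts. A ` \<Delta>\<^sub>e = \<Delta>\<^sub>e}" using A(1) by blast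
next
  fix \<sigma> assume "\<sigma> \<in> (\<lambda>A. restrict A \<Delta>\<^sub>e) ` {A \<in> root_auts. A ` \<Delta>\<^sub>e = \<Delta>\<^sub>e}"
  then obtain A where A: "A \<in> root_auts" "A ` \<Delta>\<^sub>e = \<Delta>\<^sub>e" "\<sigma> = restrict A \<Delta>\<^sub>e" by blast
  have "\<sigma> \<in> Bij \<Delta>\<^sub>e" unfolding A(3) by (rule restrict_Bij[OF root_aut_bij[OF A(1)] A(2)])
  moreover have "cartan_int (\<sigma> \<alpha>) (\<sigma> \<beta>) = cartan_int \<alpha> \<beta>" if "\<alpha> \<in> \<Delta>\<^sub>e" "\<beta> \<in> \<Delta>\<^sub>e" for \<alpha> \<beta>
    using root_aut_cartan_int[OF A(1) ext_node_root[OF that(1)] ext_node_root[OF that(2)]] that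
    by (simp only: A(3) restrict_apply')
  ultimately show "\<sigma> \<in> carrier AutE" unfolding AutE_iff by blast
qed

lemma AutD_mult:
  assumes "A \<in> root_auts" "A ` \<Delta> = \<Delta>" "B \<in> root_auts" "B ` \<Delta> = \<Delta>"
  shows "restrict A \<Delta> \<otimes>\<^bsub>AutD\<^esub> restrict B \<Delta> = restrict (A \<circ> B) \<Delta>"
  using restrict_Bij[OF root_aut_bij[OF assms(1)] assms(2)]
    restrict_Bij[OF root_aut_bij[OF assms(3)] assms(4)]
  by (simp add: diagram_auts_mult dynkin_diagram_simps compose_restrict[OF assms(4)])

lemma AutE_mult:
  assumes "A \<in> root_auts" "A ` \<Delta>\<^sub>e = \<Delta>\<^sub>e" "B \<in> root_auts" "B ` \<Delta>\<^sub>e = \<Delta>\<^sub>e"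
  shows "restrict A \<Delta>\<^sub>e \<otimes>\<^bsub>AutE\<^esub> restrict B \<Delta>\<^sub>e = restrict (A \<circ> B) \<Delta>\<^sub>e"
  using restrict_Bij[OF root_aut_bij[OF assms(1)] assms(2)]
    restrict_Bij[OF root_aut_bij[OF assms(3)] assms(4)]
  unfolding extended_dynkin_diagram_def
  by (subst diagram_auts_mult) (simp_all only: dynkin_diagram_simps compose_restrict[OF assms(4)])

lemma AutE_one: "\<one>\<^bsub>AutE\<^esub> = restrict id \<Delta>\<^sub>e"
  unfolding diagram_auts_one extended_dynkin_diagram_def dynkin_diagram_simps
  by (rule restrict_ext) (rule id_apply[symmetric])

lemma root_aut_fixes_highest:
  assumes A: "A \<in> root_auts" and img: "A ` \<Delta> = \<Delta>"
  shows "A \<alpha>\<^sub>0 = \<alpha>\<^sub>0"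
  using root_aut_ht_ge[OF A _ highest_pos] img simple_pos
  by (intro eq_highest_if_ht_ge root_aut_root[OF A highest_is_root]) blast

lemma root_aut_ext_nodes:
  assumes A: "A \<in> root_auts" and img: "A ` \<Delta> = \<Delta>"
  shows "A ` \<Delta>\<^sub>e = \<Delta>\<^sub>e"
  using img by (simp add: linear_neg[OF root_aut_linear[OF A]] root_aut_fixes_highest[OF A img])

lemma extend_aut_restrict:
  assumes A: "A \<in> root_auts" and img: "A ` \<Delta> = \<Delta>"
  shows "extend_aut \<Delta> \<alpha>\<^sub>0 (restrict A \<Delta>) = restrict A \<Delta>\<^sub>e"
  by (auto simp: extend_aut_def fun_eq_iff linear_neg[OF root_aut_linear[OF A]]
      root_aut_fixes_highest[OF A img])

lemma extend_aut_mon: "extend_aut \<Delta> \<alpha>\<^sub>0 \<in> mon AutD AutE"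
  unfolding mon_def
proof (intro CollectI conjI homI inj_onI)
  fix \<sigma> assume "\<sigma> \<in> carrier AutD"
  then obtain A where A: "A \<in> root_auts" "A ` \<Delta> = \<Delta>" "\<sigma> = restrict A \<Delta>"
    unfolding AutD_carrier by blast
  with root_aut_ext_nodes[OF A(1,2)] show "extend_aut \<Delta> \<alpha>\<^sub>0 \<sigma> \<in> carrier AutE"
    unfolding AutE_carrier A(3) extend_aut_restrict[OF A(1,2)] by blast
next
  fix \<sigma> \<tau> assume \<sigma>: "\<sigma> \<in> carrier AutD" and \<tau>: "\<tau> \<in> carrier AutD"
  obtain A where A: "A \<in> root_auts" "A ` \<Delta> = \<Delta>" "\<sigma> = restrict A \<Delta>"
    using \<sigma> unfolding AutD_carrier by blast
  obtain B where B: "B \<in> root_auts" "B ` \<Delta> = \<Delta>" "\<tau> = restrict B \<Delta>"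
    using \<tau> unfolding AutD_carrier by blast
  have AB: "(A \<circ> B) ` \<Delta> = \<Delta>" using A(2) B(2) by (simp only: image_comp[symmetric])
  show "extend_aut \<Delta> \<alpha>\<^sub>0 (\<sigma> \<otimes>\<^bsub>AutD\<^esub> \<tau>) = extend_aut \<Delta> \<alpha>\<^sub>0 \<sigma> \<otimes>\<^bsub>AutE\<^esub> extend_aut \<Delta> \<alpha>\<^sub>0 \<tau>"
    unfolding A(3) B(3) AutD_mult[OF A(1,2) B(1,2)] extend_aut_restrict[OF A(1,2)]
      extend_aut_restrict[OF B(1,2)] extend_aut_restrict[OF root_aut_comp[OF A(1) B(1)] AB]
    by (rule AutE_mult[OF A(1) root_aut_ext_nodes[OF A(1,2)] B(1) root_aut_ext_nodes[OF B(1,2)], symmetric])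
next
  fix \<sigma> \<tau> assume *: "\<sigma> \<in> carrier AutD" "\<tau> \<in> carrier AutD" "extend_aut \<Delta> \<alpha>\<^sub>0 \<sigma> = extend_aut \<Delta> \<alpha>\<^sub>0 \<tau>"
  have "\<sigma> \<beta> = \<tau> \<beta>" if "\<beta> \<in> \<Delta>" for \<beta>
    using fun_cong[OF *(3), of \<beta>] that minus_highest_not_simple
    by (auto simp: extend_aut_def split: if_splits)
  thus "\<sigma> = \<tau>"
    using *(1,2) by (intro extensionalityI[of _ \<Delta>]) (auto simp: AutD_iff Bij_imp_extensional)
qed

end

section \<open>The extended affine Weyl group\<close>

context based_root_system
begin

lemma contragredient_apply:
  assumes "w \<in> weyl_group \<Phi>"
  shows "blinfun_apply (contragredient w x) v = blinfun_apply x (inv_into UNIV w v)"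
proof -
  have "linear (\<lambda>v. blinfun_apply x (inv_into UNIV w v))"
    using linear_compose[OF weyl_linear[OF weyl_inv[OF assms]]
        bounded_linear.linear[OF blinfun.bounded_linear_right[of x]]] unfolding o_def .
  thus ?thesis
    unfolding contragredient_def
    by (simp only: bounded_linear_Blinfun_apply linear_conv_bounded_linear)
qed

lemma affine_weyl_elt_apply:
  assumes "w \<in> weyl_group \<Phi>"
  shows "blinfun_apply (affine_weyl_elt x w y) v
    = blinfun_apply x v + blinfun_apply y (inv_into UNIV w v)"
  by (simp add: affine_weyl_elt_def blinfun.add_left contragredient_apply[OF assms])

lemma weyl_inv_apply:
  "w \<in> weyl_group \<Phi> \<Longrightarrow> inv_into UNIV w (w v) = v"
  "w \<in> weyl_group \<Phi> \<Longrightarrow> w (inv_into UNIV w v) = v"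
  using weyl_bij by (auto simp: bij_def surj_f_inv_f)

lemma weyl_inv_comp:
  assumes "w \<in> weyl_group \<Phi>" "u \<in> weyl_group \<Phi>"
  shows "inv_into UNIV (w \<circ> u) v = inv_into UNIV u (inv_into UNIV w v)"
  by (simp only: o_inv_distrib[OF weyl_bij[OF assms(1)] weyl_bij[OF assms(2)]] o_apply)

lemma affine_weyl_elt_comp:
  assumes "w \<in> weyl_group \<Phi>" "u \<in> weyl_group \<Phi>"
  shows "affine_weyl_elt x w \<circ> affine_weyl_elt y u = affine_weyl_elt (x + contragredient w y) (w \<circ> u)"
proof (rule ext, rule blinfun_eqI)
  fix z v
  show "blinfun_apply ((affine_weyl_elt x w \<circ> affine_weyl_elt y u) z) v
      = blinfun_apply (affine_weyl_elt (x + contragredient w y) (w \<circ> u) z) v"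
    unfolding o_apply affine_weyl_elt_apply[OF assms(1)] affine_weyl_elt_apply[OF assms(2)]
      affine_weyl_elt_apply[OF weyl_comp[OF assms]] blinfun.add_left
      contragredient_apply[OF assms(1)] weyl_inv_comp[OF assms]
    by (simp only: add.assoc)
qed

lemma affine_weyl_elt_id: "affine_weyl_elt 0 (id :: 'a \<Rightarrow> 'a) = id"
  by (rule ext, rule blinfun_eqI)
    (simp only: affine_weyl_elt_apply[OF weyl_id] inv_id id_apply blinfun.zero_left add_0_left)

lemma affine_weyl_elt_inject:
  assumes w: "w \<in> weyl_group \<Phi>" and u: "u \<in> weyl_group \<Phi>"
    and eq: "affine_weyl_elt x w = affine_weyl_elt y u"
  shows "x = y" "w = u"
proof -
  have *: "blinfun_apply x v + blinfun_apply z (inv_into UNIV w v)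
      = blinfun_apply y v + blinfun_apply z (inv_into UNIV u v)" for z v
    using arg_cong[OF fun_cong[OF eq, of z], of "\<lambda>f. blinfun_apply f v"]
    by (simp only: affine_weyl_elt_apply w u)
  show xy: "x = y"
  proof (rule blinfun_eqI)
    show "blinfun_apply x v = blinfun_apply y v" for v using *[of v 0] by simp
  qed
  have "inv_into UNIV w v = inv_into UNIV u v" for v
  proof (rule coeff_eq_imp_eq)
    show "coeff \<alpha> (inv_into UNIV w v) = coeff \<alpha> (inv_into UNIV u v)" for \<alpha>
      using *[of v "fundamental_coweight \<Delta> \<alpha>"] by (simp only: xy add_left_cancel)
  qed
  hence "inv_into UNIV w = inv_into UNIV u" by (rule ext)
  thus "w = u" using inv_inv_eq[OF weyl_bij[OF w]] inv_inv_eq[OF weyl_bij[OF u]] by metis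
qed

text \<open>
  The coweight lattice consists of the functionals that are integral on the roots.
\<close>

lemma coweight_lattice_iff: "x \<in> coweight_lattice \<Delta> \<longleftrightarrow> (\<forall>\<alpha>\<in>\<Delta>. blinfun_apply x \<alpha> \<in> \<int>)"
proof
  assume "x \<in> coweight_lattice \<Delta>"
  then obtain c :: "'a \<Rightarrow> int" where c: "x = (\<Sum>\<alpha>\<in>\<Delta>. of_int (c \<alpha>) *\<^sub>R fundamental_coweight \<Delta> \<alpha>)"
    unfolding coweight_lattice_def by blast
  show "\<forall>\<alpha>\<in>\<Delta>. blinfun_apply x \<alpha> \<in> \<int>"
    by (auto simp: c blinfun.sum_left blinfun.scaleR_left coeff_simple intro!: Ints_sum Ints_mult)
next
  assume int: "\<forall>\<alpha>\<in>\<Delta>. blinfun_apply x \<alpha> \<in> \<int>"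
  define c where "c \<alpha> = \<lfloor>blinfun_apply x \<alpha>\<rfloor>" for \<alpha>
  have "x = (\<Sum>\<alpha>\<in>\<Delta>. of_int (c \<alpha>) *\<^sub>R fundamental_coweight \<Delta> \<alpha>)"
  proof (rule blinfun_eq_simple)
    fix \<beta> assume \<beta>: "\<beta> \<in> \<Delta>"
    have "blinfun_apply (\<Sum>\<alpha>\<in>\<Delta>. of_int (c \<alpha>) *\<^sub>R fundamental_coweight \<Delta> \<alpha>) \<beta>
        = (\<Sum>\<alpha>\<in>\<Delta>. if \<alpha> = \<beta> then of_int (c \<alpha>) else 0)"
      using \<beta> by (auto simp: blinfun.sum_left blinfun.scaleR_left coeff_simple intro!: sum.cong)
    also have "\<dots> = blinfun_apply x \<beta>"
      using \<beta> finite_simple int by (simp add: c_def)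
    finally show "blinfun_apply x \<beta>
        = blinfun_apply (\<Sum>\<alpha>\<in>\<Delta>. of_int (c \<alpha>) *\<^sub>R fundamental_coweight \<Delta> \<alpha>) \<beta>" by simp
  qed
  thus "x \<in> coweight_lattice \<Delta>" unfolding coweight_lattice_def by blast
qed

lemma coweight_root_Ints:
  assumes "x \<in> coweight_lattice \<Delta>" "\<beta> \<in> \<Phi>" shows "blinfun_apply x \<beta> \<in> \<int>"
proof -
  have "blinfun_apply x \<beta> = (\<Sum>\<alpha>\<in>\<Delta>. coeff \<alpha> \<beta> *\<^sub>R blinfun_apply x \<alpha>)"
    by (intro linear_expansion bounded_linear.linear blinfun.bounded_linear_right)
  also have "\<dots> \<in> \<int>"
    using assms coeff_root_Ints unfolding coweight_lattice_iff real_scaleR_def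
    by (intro Ints_sum Ints_mult) blast+
  finally show ?thesis .
qed

lemma coweight_lattice_contragredient:
  assumes "x \<in> coweight_lattice \<Delta>" "w \<in> weyl_group \<Phi>"
  shows "contragredient w x \<in> coweight_lattice \<Delta>"
  unfolding coweight_lattice_iff contragredient_apply[OF assms(2)]
  using coweight_root_Ints[OF assms(1)] root_aut_root[OF weyl_root_aut[OF weyl_inv[OF assms(2)]]]
    simple_root by blast

lemma coweight_lattice_add:
  "x \<in> coweight_lattice \<Delta> \<Longrightarrow> y \<in> coweight_lattice \<Delta> \<Longrightarrow> x + y \<in> coweight_lattice \<Delta>"
  by (auto simp: coweight_lattice_iff blinfun.add_left)

lemma coweight_lattice_uminus: "x \<in> coweight_lattice \<Delta> \<Longrightarrow> - x \<in> coweight_lattice \<Delta>"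
  by (auto simp: coweight_lattice_iff blinfun.minus_left)

lemma coweight_lattice_0: "0 \<in> coweight_lattice \<Delta>"
  by (auto simp: coweight_lattice_iff)

lemma affine_weyl_elt_left_inverse:
  assumes "w \<in> weyl_group \<Phi>"
  shows "affine_weyl_elt (- contragredient (inv_into UNIV w) x) (inv_into UNIV w)
    \<circ> affine_weyl_elt x w = id"
proof -
  have "inv_into UNIV w \<circ> w = id" using weyl_inv_apply[OF assms] by (simp add: fun_eq_iff)
  thus ?thesis
    by (simp only: affine_weyl_elt_comp[OF weyl_inv[OF assms] assms] affine_weyl_elt_id left_minus)
qed

lemma affine_weyl_elt_right_inverse:
  assumes "w \<in> weyl_group \<Phi>"
  shows "affine_weyl_elt x w
    \<circ> affine_weyl_elt (- contragredient (inv_into UNIV w) x) (inv_into UNIV w) = id"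
  (is "?T \<circ> ?S = id")
proof -
  have "?T \<circ> ?S = affine_weyl_elt (x + contragredient w (- contragredient (inv_into UNIV w) x)) (w \<circ> inv_into UNIV w)"
    by (rule affine_weyl_elt_comp[OF assms weyl_inv[OF assms]])
  also have "w \<circ> inv_into UNIV w = id" using weyl_inv_apply[OF assms] by (simp add: fun_eq_iff)
  also have "x + contragredient w (- contragredient (inv_into UNIV w) x) = 0"
    by (rule blinfun_eqI)
      (simp add: blinfun.add_left blinfun.minus_left contragredient_apply assms weyl_inv
        weyl_inv_apply inv_inv_eq weyl_bij)
  finally show ?thesis by (simp only: affine_weyl_elt_id)
qed

lemma bij_affine_weyl_elt: "w \<in> weyl_group \<Phi> \<Longrightarrow> bij (affine_weyl_elt x w)"
  by (rule o_bij[OF affine_weyl_elt_left_inverse affine_weyl_elt_right_inverse])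

lemma inv_affine_weyl_elt:
  "w \<in> weyl_group \<Phi> \<Longrightarrow> inv_into UNIV (affine_weyl_elt x w)
    = affine_weyl_elt (- contragredient (inv_into UNIV w) x) (inv_into UNIV w)"
  by (rule inv_unique_comp[OF affine_weyl_elt_right_inverse affine_weyl_elt_left_inverse])

lemma weyl_part_affine_weyl_elt:
  assumes "x \<in> coweight_lattice \<Delta>" "w \<in> weyl_group \<Phi>"
  shows "weyl_part \<Phi> \<Delta> (affine_weyl_elt x w) = w"
  unfolding weyl_part_def
  using assms affine_weyl_elt_inject(2) by (intro the_equality) blast+

end

section \<open>The stabilizer of the fundamental alcove\<close>

context highest_root_system
begin

abbreviation "alcove \<equiv> fundamental_alcove \<Delta> \<alpha>\<^sub>0"
abbreviation "\<Omega> \<equiv> alcove_stabilizer \<Phi> \<Delta> \<alpha>\<^sub>0"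

text \<open>
  The constant term of the affine function \<open>\<beta> + level \<beta>\<close> whose nonnegativity defines the wall of the
  fundamental alcove that belongs to the extended node \<open>\<beta>\<close>.
\<close>

definition level :: "'a \<Rightarrow> real" where
  "level \<beta> = (if \<beta> = - \<alpha>\<^sub>0 then 1 else 0)"

lemma alcove_iff: "y \<in> alcove \<longleftrightarrow> (\<forall>\<beta>\<in>\<Delta>\<^sub>e. blinfun_apply y \<beta> + level \<beta> \<ge> 0)"
  using minus_highest_not_simple
  by (auto simp: fundamental_alcove_def level_def blinfun.minus_right)

lemma zero_in_alcove: "0 \<in> alcove"
  by (simp add: fundamental_alcove_def)

lemma alcove_pos: "y \<in> alcove \<Longrightarrow> \<beta> \<in> pos \<Longrightarrow> blinfun_apply y \<beta> \<ge> 0"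
proof -
  assume y: "y \<in> alcove" and \<beta>: "\<beta> \<in> pos"
  have "blinfun_apply y \<beta> = (\<Sum>\<alpha>\<in>\<Delta>. coeff \<alpha> \<beta> *\<^sub>R blinfun_apply y \<alpha>)"
    by (intro linear_expansion bounded_linear.linear blinfun.bounded_linear_right)
  also have "\<dots> \<ge> 0"
    using y \<beta> by (intro sum_nonneg) (auto simp: fundamental_alcove_def pos_def)
  finally show ?thesis .
qed

lemma alcove_root_le_1: "y \<in> alcove \<Longrightarrow> \<beta> \<in> \<Phi> \<Longrightarrow> blinfun_apply y \<beta> \<le> 1"
proof -
  assume y: "y \<in> alcove" and \<beta>: "\<beta> \<in> \<Phi>"
  have "blinfun_apply y (\<alpha>\<^sub>0 - \<beta>) = (\<Sum>\<alpha>\<in>\<Delta>. coeff \<alpha> (\<alpha>\<^sub>0 - \<beta>) *\<^sub>R blinfun_apply y \<alpha>)"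
    by (intro linear_expansion bounded_linear.linear blinfun.bounded_linear_right)
  also have "\<dots> \<ge> 0"
    using y coeff_le_highest[OF \<beta>]
    by (intro sum_nonneg) (auto simp: fundamental_alcove_def blinfun.diff_right)
  finally have "blinfun_apply y \<beta> \<le> blinfun_apply y \<alpha>\<^sub>0" by (simp add: blinfun.diff_right)
  also have "\<dots> \<le> 1" using y by (simp add: fundamental_alcove_def)
  finally show ?thesis .
qed

lemma ht_highest_ge_1: "ht \<alpha>\<^sub>0 \<ge> 1"
  by (rule ht_pos_ge_1[OF highest_pos])

lemma scaled_ht_in_alcove: "(1 / ht \<alpha>\<^sub>0) *\<^sub>R ht \<in> alcove"
  using ht_highest_ge_1 by (auto simp: fundamental_alcove_def blinfun.scaleR_left)

lemma alcove_wall: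
  assumes "\<beta> \<in> \<Delta>\<^sub>e" obtains y where "y \<in> alcove" "blinfun_apply y \<beta> + level \<beta> = 0"
proof (cases "\<beta> = - \<alpha>\<^sub>0")
  case True
  thus ?thesis using that[OF scaled_ht_in_alcove] ht_highest_ge_1
    by (simp add: level_def blinfun.scaleR_left blinfun.minus_right)
next
  case False
  thus ?thesis using that[OF zero_in_alcove] by (simp add: level_def)
qed

text \<open>
  An affine root \<open>\<gamma> + k\<close> that is nonnegative on the alcove and vanishes somewhere on it has affine
  height at least one, with equality only for the affine roots of the walls. If \<open>\<gamma>\<close> is positive, the
  origin gives \<open>k = 0\<close>; if \<open>\<gamma>\<close> is negative, then \<open>k = 1\<close> because \<open>- \<gamma>\<close> takes values between \<open>0\<close> and \<open>1\<close>
  on the alcove and is positive at its point \<open>ht / ht \<alpha>\<^sub>0\<close>.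
\<close>

lemma affine_root_tight_on_alcove:
  assumes \<gamma>: "\<gamma> \<in> \<Phi>" and k: "k \<in> \<int>"
    and nonneg: "\<And>y. y \<in> alcove \<Longrightarrow> blinfun_apply y \<gamma> + k \<ge> 0"
    and tight: "y \<in> alcove" "blinfun_apply y \<gamma> + k = 0"
  shows "ht \<gamma> + (1 + ht \<alpha>\<^sub>0) * k \<ge> 1"
    and "ht \<gamma> + (1 + ht \<alpha>\<^sub>0) * k = 1 \<Longrightarrow> \<gamma> \<in> \<Delta>\<^sub>e \<and> k = level \<gamma>"
proof -
  have "ht \<gamma> + (1 + ht \<alpha>\<^sub>0) * k \<ge> 1 \<and>
      (ht \<gamma> + (1 + ht \<alpha>\<^sub>0) * k = 1 \<longrightarrow> \<gamma> \<in> \<Delta>\<^sub>e \<and> k = level \<gamma>)"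
  proof (cases "\<gamma> \<in> pos")
    case True
    have "k = 0"
      using nonneg[OF zero_in_alcove] tight(2) alcove_pos[OF tight(1) True] by simp
    moreover have "\<gamma> \<noteq> - \<alpha>\<^sub>0" using True uminus_not_pos[OF highest_pos] by blast
    ultimately show ?thesis
      using ht_pos_ge_1[OF True] ht_1_simple[OF True] by (simp add: level_def)
  next
    case False
    hence neg: "- \<gamma> \<in> pos" using pos_cases[OF \<gamma>] by blast
    have "ht \<gamma> \<le> -1" using ht_pos_ge_1[OF neg] by (simp add: blinfun.minus_right)
    hence "ht \<gamma> / ht \<alpha>\<^sub>0 < 0" using ht_highest_ge_1 by (intro divide_neg_pos) auto
    moreover have "ht \<gamma> / ht \<alpha>\<^sub>0 + k \<ge> 0"
      using nonneg[OF scaled_ht_in_alcove] by (simp add: blinfun.scaleR_left)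
    ultimately have "k > 0" by linarith
    moreover have "k \<le> 1"
      using tight(2) alcove_root_le_1[OF tight(1) uminus_root[OF \<gamma>]]
      by (simp add: blinfun.minus_right)
    ultimately have "k = 1" using k by (auto elim: Ints_cases)
    moreover have "- ht \<gamma> \<le> ht \<alpha>\<^sub>0"
      using ht_le_highest[OF uminus_root[OF \<gamma>]] by (simp add: blinfun.minus_right)
    moreover have "\<gamma> = - \<alpha>\<^sub>0" if "- ht \<gamma> = ht \<alpha>\<^sub>0"
      using eq_highest_if_ht_ge[OF uminus_root[OF \<gamma>]] that
      by (simp add: blinfun.minus_right minus_equation_iff[of \<gamma>])
    ultimately show ?thesis by (auto simp: level_def)
  qed
  thus "ht \<gamma> + (1 + ht \<alpha>\<^sub>0) * k \<ge> 1"
    and "ht \<gamma> + (1 + ht \<alpha>\<^sub>0) * k = 1 \<Longrightarrow> \<gamma> \<in> \<Delta>\<^sub>e \<and> k = level \<gamma>" by blast+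
qed

lemma sum_marks_blinfun:
  "linear f \<Longrightarrow> (\<Sum>\<beta>\<in>\<Delta>\<^sub>e. mark \<beta> * blinfun_apply x (f \<beta>)) = 0"
proof -
  assume f: "linear f"
  have "linear (\<lambda>v. blinfun_apply x (f v))"
    using linear_compose[OF f bounded_linear.linear[OF blinfun.bounded_linear_right[of x]]]
    by (simp add: o_def)
  from sum_marks_linear[OF this] show ?thesis by (simp only: real_scaleR_def)
qed

lemma sum_marks_level: "(\<Sum>\<beta>\<in>\<Delta>\<^sub>e. mark \<beta> * level \<beta>) = 1"
proof -
  have "(\<Sum>\<beta>\<in>\<Delta>. mark \<beta> * level \<beta>) = 0"
    using minus_highest_not_simple by (intro sum.neutral) (auto simp: level_def)
  thus ?thesis by (simp only: sum_ext_nodes) (simp add: level_def)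
qed

text \<open>
  Composed with \<open>affine_weyl_elt x w\<close>, the function \<open>\<beta> + level \<beta>\<close> becomes
  \<open>inv w \<beta> + (x \<beta> + level \<beta>)\<close>; the condition says that these are again the functions of the walls.
\<close>

lemma affine_stabilizes_alcove_iff:
  assumes x: "x \<in> coweight_lattice \<Delta>" and w: "w \<in> weyl_group \<Phi>"
  shows "affine_weyl_elt x w ` alcove = alcove \<longleftrightarrow>
    w ` \<Delta>\<^sub>e = \<Delta>\<^sub>e \<and> (\<forall>\<beta>\<in>\<Delta>\<^sub>e. blinfun_apply x \<beta> + level \<beta> = level (inv_into UNIV w \<beta>))"
    (is "?T ` _ = _ \<longleftrightarrow> _")
proof -
  let ?v = "inv_into UNIV w"
  have v: "?v \<in> weyl_group \<Phi>" by (rule weyl_inv[OF w])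
  have T: "blinfun_apply (?T y) \<beta> = blinfun_apply x \<beta> + blinfun_apply y (?v \<beta>)" for y \<beta>
    by (rule affine_weyl_elt_apply[OF w])
  show ?thesis
  proof
    assume img: "?T ` alcove = alcove"
    define k where "k \<beta> = blinfun_apply x \<beta> + level \<beta>" for \<beta>
    define L where "L \<beta> = ht (?v \<beta>) + (1 + ht \<alpha>\<^sub>0) * k \<beta>" for \<beta>
    have *: "L \<beta> \<ge> 1 \<and> (L \<beta> = 1 \<longrightarrow> ?v \<beta> \<in> \<Delta>\<^sub>e \<and> k \<beta> = level (?v \<beta>))" if \<beta>: "\<beta> \<in> \<Delta>\<^sub>e" for \<beta>
    proof -
      have root: "?v \<beta> \<in> \<Phi>"
        by (rule root_aut_root[OF weyl_root_aut[OF v] ext_node_root[OF \<beta>]])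
      have int: "k \<beta> \<in> \<int>"
        using coweight_root_Ints[OF x ext_node_root[OF \<beta>]] by (simp add: k_def level_def)
      have nonneg: "blinfun_apply y (?v \<beta>) + k \<beta> \<ge> 0" if "y \<in> alcove" for y
      proof -
        have "?T y \<in> alcove" using img that by blast
        hence "blinfun_apply (?T y) \<beta> + level \<beta> \<ge> 0" using \<beta> unfolding alcove_iff by (rule bspec)
        thus ?thesis by (simp add: T k_def)
      qed
      obtain z where z: "z \<in> alcove" "blinfun_apply z \<beta> + level \<beta> = 0" using alcove_wall[OF \<beta>] .
      have "z \<in> ?T ` alcove" using z(1) by (simp only: img)
      then obtain y where y: "y \<in> alcove" "z = ?T y" by blast
      have "blinfun_apply y (?v \<beta>) + k \<beta> = 0" using z(2) by (simp add: y(2) T k_def)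
      from affine_root_tight_on_alcove[OF root int nonneg y(1) this] show ?thesis
        unfolding L_def by blast
    qed
    \<comment> \<open>The mean of the affine heights \<open>L \<beta>\<close>, weighted by the marks, is one; as none of them is
      smaller, they all equal one.\<close>
    have "(\<Sum>\<beta>\<in>\<Delta>\<^sub>e. mark \<beta> * (L \<beta> - 1)) = 0"
    proof -
      have "(\<Sum>\<beta>\<in>\<Delta>\<^sub>e. mark \<beta> * L \<beta>) = (\<Sum>\<beta>\<in>\<Delta>\<^sub>e. mark \<beta> * ht (?v \<beta>))
          + (1 + ht \<alpha>\<^sub>0) * ((\<Sum>\<beta>\<in>\<Delta>\<^sub>e. mark \<beta> * blinfun_apply x \<beta>) + (\<Sum>\<beta>\<in>\<Delta>\<^sub>e. mark \<beta> * level \<beta>))"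
        by (simp only: L_def k_def distrib_left sum.distrib sum_distrib_left mult.left_commute)
      also have "\<dots> = 1 + ht \<alpha>\<^sub>0"
        using sum_marks_blinfun[OF weyl_linear[OF v], of ht] sum_marks_blinfun[OF linear_ident, of x]
        by (simp only: sum_marks_level) simp
      also have "\<dots> = (\<Sum>\<beta>\<in>\<Delta>\<^sub>e. mark \<beta>)"
        by (simp only: sum_ext_nodes mark_minus_highest) (simp add: mark_simple ht_eq)
      finally show ?thesis by (simp only: right_diff_distrib sum_subtractf mult_1_right)
    qed
    moreover have "mark \<beta> * (L \<beta> - 1) \<ge> 0" if "\<beta> \<in> \<Delta>\<^sub>e" for \<beta>
      using *[OF that] mark_ge_1[OF that] by simp
    ultimately have zero: "mark \<beta> * (L \<beta> - 1) = 0" if "\<beta> \<in> \<Delta>\<^sub>e" for \<beta>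
      using sum_nonneg_eq_0_iff[OF finite_ext_nodes, of "\<lambda>\<beta>. mark \<beta> * (L \<beta> - 1)"] that by blast
    have L1: "L \<beta> = 1" if "\<beta> \<in> \<Delta>\<^sub>e" for \<beta>
      using zero[OF that] mark_ge_1[OF that] by simp
    have "?v ` \<Delta>\<^sub>e = \<Delta>\<^sub>e"
    proof (rule endo_inj_surj[OF finite_ext_nodes])
      show "?v ` \<Delta>\<^sub>e \<subseteq> \<Delta>\<^sub>e" using * L1 by blast
      show "inj_on ?v \<Delta>\<^sub>e" using bij_is_inj[OF weyl_bij[OF v]] by (rule inj_on_subset) simp
    qed
    hence "w ` ?v ` \<Delta>\<^sub>e = w ` \<Delta>\<^sub>e" by (simp only:)
    hence "w ` \<Delta>\<^sub>e = \<Delta>\<^sub>e" by (simp only: image_image weyl_inv_apply[OF w] image_ident)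
    moreover have "\<forall>\<beta>\<in>\<Delta>\<^sub>e. blinfun_apply x \<beta> + level \<beta> = level (?v \<beta>)"
      using * L1 unfolding k_def by blast
    ultimately show "w ` \<Delta>\<^sub>e = \<Delta>\<^sub>e \<and> (\<forall>\<beta>\<in>\<Delta>\<^sub>e. blinfun_apply x \<beta> + level \<beta> = level (?v \<beta>))" by blast
  next
    assume *: "w ` \<Delta>\<^sub>e = \<Delta>\<^sub>e \<and> (\<forall>\<beta>\<in>\<Delta>\<^sub>e. blinfun_apply x \<beta> + level \<beta> = level (?v \<beta>))"
    have iff: "?T y \<in> alcove \<longleftrightarrow> y \<in> alcove" for y
    proof -
      have "?T y \<in> alcove \<longleftrightarrow> (\<forall>\<beta>\<in>\<Delta>\<^sub>e. blinfun_apply y (?v \<beta>) + level (?v \<beta>) \<ge> 0)"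
        unfolding alcove_iff T
      proof (rule ball_cong[OF refl])
        fix \<beta> assume "\<beta> \<in> \<Delta>\<^sub>e"
        hence "level (?v \<beta>) = blinfun_apply x \<beta> + level \<beta>"
          using bspec[OF conjunct2[OF *]] by simp
        thus "0 \<le> blinfun_apply x \<beta> + blinfun_apply y (?v \<beta>) + level \<beta> \<longleftrightarrow>
            0 \<le> blinfun_apply y (?v \<beta>) + level (?v \<beta>)"
          by (simp only: ac_simps)
      qed
      also have "\<dots> \<longleftrightarrow> (\<forall>\<beta>\<in>w ` \<Delta>\<^sub>e. blinfun_apply y (?v \<beta>) + level (?v \<beta>) \<ge> 0)"
        using * by (simp only:)
      also have "\<dots> \<longleftrightarrow> y \<in> alcove"
        unfolding alcove_iff by (simp only: ball_simps weyl_inv_apply[OF w])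
      finally show ?thesis .
    qed
    show "?T ` alcove = alcove"
    proof (intro equalityI subsetI)
      fix z assume z: "z \<in> alcove"
      obtain y where "z = ?T y" using bij_affine_weyl_elt[OF w] by (metis bij_pointE)
      thus "z \<in> ?T ` alcove" using z iff by blast
    qed (use iff in blast)
  qed
qed

lemma alcove_stabilizer_iff:
  "\<phi> \<in> carrier \<Omega> \<longleftrightarrow> (\<exists>x w. \<phi> = affine_weyl_elt x w \<and> x \<in> coweight_lattice \<Delta> \<and> w \<in> weyl_group \<Phi> \<and>
     w ` \<Delta>\<^sub>e = \<Delta>\<^sub>e \<and> (\<forall>\<beta>\<in>\<Delta>\<^sub>e. blinfun_apply x \<beta> + level \<beta> = level (inv_into UNIV w \<beta>)))"
proof -
  have "\<phi> \<in> carrier \<Omega> \<longleftrightarrow> (\<exists>x w. \<phi> = affine_weyl_elt x w \<and> x \<in> coweight_lattice \<Delta> \<and>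
      w \<in> weyl_group \<Phi> \<and> affine_weyl_elt x w ` alcove = alcove)"
    by (auto simp: alcove_stabilizer_def ext_affine_weyl_group_def)
  also have "\<dots> \<longleftrightarrow> (\<exists>x w. \<phi> = affine_weyl_elt x w \<and> x \<in> coweight_lattice \<Delta> \<and> w \<in> weyl_group \<Phi> \<and>
      w ` \<Delta>\<^sub>e = \<Delta>\<^sub>e \<and> (\<forall>\<beta>\<in>\<Delta>\<^sub>e. blinfun_apply x \<beta> + level \<beta> = level (inv_into UNIV w \<beta>)))"
    by (intro ex_cong1 conj_cong refl) (rule affine_stabilizes_alcove_iff)
  finally show ?thesis .
qed

text \<open>
  The values of the translation part \<open>x\<close> on the simple roots are forced. The value that this gives
  on \<open>- \<alpha>\<^sub>0\<close> is the required one because \<open>w\<close> preserves the marks.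
\<close>

lemma ex_alcove_stabilizer:
  assumes w: "w \<in> weyl_group \<Phi>" and img: "w ` \<Delta>\<^sub>e = \<Delta>\<^sub>e"
  shows "\<exists>x \<in> coweight_lattice \<Delta>. affine_weyl_elt x w \<in> carrier \<Omega>"
proof -
  let ?v = "inv_into UNIV w"
  have v: "?v \<in> weyl_group \<Phi>" by (rule weyl_inv[OF w])
  have vimg: "?v ` \<Delta>\<^sub>e = \<Delta>\<^sub>e"
    using image_inv_f_f[OF bij_is_inj[OF weyl_bij[OF w]], of "\<Delta>\<^sub>e"] by (simp only: img)
  obtain x :: "'a \<Rightarrow>\<^sub>L real" where x: "\<forall>\<beta>\<in>\<Delta>. blinfun_apply x \<beta> = level (?v \<beta>) - level \<beta>"
    using ex_blinfun_simple[of "\<lambda>\<beta>. level (?v \<beta>) - level \<beta>"] by blast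
  have xP: "x \<in> coweight_lattice \<Delta>" unfolding coweight_lattice_iff using x by (simp add: level_def)
  have "(\<Sum>\<beta>\<in>\<Delta>\<^sub>e. mark \<beta> * level (?v \<beta>)) = (\<Sum>\<beta>\<in>\<Delta>\<^sub>e. mark (?v \<beta>) * level (?v \<beta>))"
    by (intro sum.cong refl) (simp only: mark_root_aut[OF weyl_root_aut[OF v] vimg])
  also have "\<dots> = (\<Sum>\<beta>\<in>?v ` \<Delta>\<^sub>e. mark \<beta> * level \<beta>)"
    using inj_on_subset[OF bij_is_inj[OF weyl_bij[OF v]], of "\<Delta>\<^sub>e"]
    by (subst sum.reindex) (simp_all add: o_def del: sum.insert image_insert)
  also have "\<dots> = 1" by (simp only: vimg sum_marks_level)
  finally have "(\<Sum>\<beta>\<in>\<Delta>\<^sub>e. mark \<beta> * (level (?v \<beta>) - level \<beta> - blinfun_apply x \<beta>)) = 0"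
    using sum_marks_level sum_marks_blinfun[OF linear_ident, of x]
    by (simp only: right_diff_distrib sum_subtractf)
  hence "level (?v (- \<alpha>\<^sub>0)) - level (- \<alpha>\<^sub>0) - blinfun_apply x (- \<alpha>\<^sub>0) = 0"
    using x by (simp only: sum_ext_nodes mark_minus_highest) simp
  with x have "\<forall>\<beta>\<in>\<Delta>\<^sub>e. blinfun_apply x \<beta> + level \<beta> = level (?v \<beta>)"
    by (intro ballI) (elim insertE, simp_all)
  with xP w img show ?thesis unfolding alcove_stabilizer_iff by blast
qed

lemma group_alcove_stabilizer: "group \<Omega>"
proof -
  interpret B: group "BijGroup (UNIV :: ('a \<Rightarrow>\<^sub>L real) set)" by (rule group_BijGroup)
  have mem: "\<phi> \<in> carrier \<Omega> \<longleftrightarrow> (\<exists>x w. \<phi> = affine_weyl_elt x w \<and> x \<in> coweight_lattice \<Delta> \<and>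
      w \<in> weyl_group \<Phi>) \<and> \<phi> ` alcove = alcove" for \<phi>
    by (auto simp: alcove_stabilizer_def ext_affine_weyl_group_def)
  have bij: "bij \<phi>" if "\<phi> \<in> carrier \<Omega>" for \<phi>
    using that bij_affine_weyl_elt unfolding mem by blast
  have "subgroup (carrier \<Omega>) (BijGroup UNIV)"
  proof (rule B.subgroupI)
    show "carrier \<Omega> \<subseteq> carrier (BijGroup UNIV)"
      using bij by (auto simp: BijGroup_def Bij_UNIV)
    have "id \<in> carrier \<Omega>"
      unfolding mem
      by (intro conjI exI[of _ 0] exI[of _ id] coweight_lattice_0 weyl_id
          affine_weyl_elt_id[symmetric]) simp
    thus "carrier \<Omega> \<noteq> {}" by blast
    fix \<phi> assume \<phi>: "\<phi> \<in> carrier \<Omega>"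
    then obtain x w where xw: "\<phi> = affine_weyl_elt x w" "x \<in> coweight_lattice \<Delta>" "w \<in> weyl_group \<Phi>"
      unfolding mem by blast
    have "\<phi> ` alcove = alcove" using \<phi> unfolding mem by blast
    hence "inv_into UNIV \<phi> ` alcove = alcove"
      using image_inv_f_f[OF bij_is_inj[OF bij[OF \<phi>]], of alcove] by simp
    moreover have "inv_into UNIV \<phi>
        = affine_weyl_elt (- contragredient (inv_into UNIV w) x) (inv_into UNIV w)"
      unfolding xw(1) by (rule inv_affine_weyl_elt[OF xw(3)])
    ultimately have "inv_into UNIV \<phi> \<in> carrier \<Omega>"
      unfolding mem using weyl_inv[OF xw(3)]
        coweight_lattice_uminus[OF coweight_lattice_contragredient[OF xw(2) weyl_inv[OF xw(3)]]]
      by blast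
    thus "inv\<^bsub>BijGroup UNIV\<^esub> \<phi> \<in> carrier \<Omega>" by (simp only: BijGroup_UNIV_inv[OF bij[OF \<phi>]])
  next
    fix \<phi> \<psi> assume \<phi>: "\<phi> \<in> carrier \<Omega>" and \<psi>: "\<psi> \<in> carrier \<Omega>"
    obtain x w where xw: "\<phi> = affine_weyl_elt x w" "x \<in> coweight_lattice \<Delta>" "w \<in> weyl_group \<Phi>"
      using \<phi> unfolding mem by blast
    obtain y u where yu: "\<psi> = affine_weyl_elt y u" "y \<in> coweight_lattice \<Delta>" "u \<in> weyl_group \<Phi>"
      using \<psi> unfolding mem by blast
    have "(\<phi> \<circ> \<psi>) ` alcove = alcove"
      using \<phi> \<psi> unfolding mem image_comp[symmetric] by simp
    moreover have "\<phi> \<circ> \<psi> = affine_weyl_elt (x + contragredient w y) (w \<circ> u)"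
      unfolding xw(1) yu(1) by (rule affine_weyl_elt_comp[OF xw(3) yu(3)])
    ultimately have "\<phi> \<circ> \<psi> \<in> carrier \<Omega>"
      unfolding mem using weyl_comp[OF xw(3) yu(3)]
        coweight_lattice_add[OF xw(2) coweight_lattice_contragredient[OF yu(2) xw(3)]] by blast
    thus "\<phi> \<otimes>\<^bsub>BijGroup UNIV\<^esub> \<psi> \<in> carrier \<Omega>"
      by (simp only: BijGroup_UNIV_mult[OF bij[OF \<phi>] bij[OF \<psi>]])
  qed
  from B.subgroup_imp_group[OF this] show ?thesis by (simp add: alcove_stabilizer_def)
qed

lemma alcove_stabilizer_mult:
  assumes "\<phi> \<in> carrier \<Omega>" "\<psi> \<in> carrier \<Omega>" shows "\<phi> \<otimes>\<^bsub>\<Omega>\<^esub> \<psi> = \<phi> \<circ> \<psi>"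
proof -
  have "bij \<phi>" "bij \<psi>" using assms bij_affine_weyl_elt unfolding alcove_stabilizer_iff by blast+
  thus ?thesis using BijGroup_UNIV_mult[of \<phi> \<psi>] by (simp add: alcove_stabilizer_def)
qed

section \<open>The action on the extended diagram\<close>

abbreviation "\<rho> \<equiv> node_action \<Phi> \<Delta> \<alpha>\<^sub>0"

lemma node_action_affine:
  "x \<in> coweight_lattice \<Delta> \<Longrightarrow> w \<in> weyl_group \<Phi> \<Longrightarrow> \<rho> (affine_weyl_elt x w) = restrict w \<Delta>\<^sub>e"
  by (simp only: node_action_def weyl_part_affine_weyl_elt)

lemma root_aut_eq_if_restrict_simple_eq:
  assumes "A \<in> root_auts" "B \<in> root_auts" "\<And>\<alpha>. \<alpha> \<in> \<Delta> \<Longrightarrow> A \<alpha> = B \<alpha>"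
  shows "A = B"
  using assms root_aut_linear by (intro linear_eq_simple) blast+

lemma root_aut_eq_if_restrict_eq:
  assumes "A \<in> root_auts" "B \<in> root_auts" "restrict A \<Delta>\<^sub>e = restrict B \<Delta>\<^sub>e"
  shows "A = B"
proof (rule root_aut_eq_if_restrict_simple_eq[OF assms(1,2)])
  fix \<alpha> assume "\<alpha> \<in> \<Delta>"
  thus "A \<alpha> = B \<alpha>" using fun_cong[OF assms(3), of \<alpha>] by simp
qed

lemma node_action_mon: "\<rho> \<in> mon \<Omega> AutE"
  unfolding mon_def
proof (intro CollectI conjI homI inj_onI)
  fix \<phi> assume "\<phi> \<in> carrier \<Omega>"
  then obtain x w where xw: "\<phi> = affine_weyl_elt x w" "x \<in> coweight_lattice \<Delta>" "w \<in> weyl_group \<Phi>"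
    "w ` \<Delta>\<^sub>e = \<Delta>\<^sub>e" unfolding alcove_stabilizer_iff by blast
  show "\<rho> \<phi> \<in> carrier AutE"
    unfolding xw(1) node_action_affine[OF xw(2,3)] AutE_carrier
    using weyl_root_aut[OF xw(3)] xw(4) by blast
next
  fix \<phi> \<psi> assume *: "\<phi> \<in> carrier \<Omega>" "\<psi> \<in> carrier \<Omega>"
  obtain x w where xw: "\<phi> = affine_weyl_elt x w" "x \<in> coweight_lattice \<Delta>" "w \<in> weyl_group \<Phi>"
    "w ` \<Delta>\<^sub>e = \<Delta>\<^sub>e" using *(1) unfolding alcove_stabilizer_iff by blast
  obtain y u where yu: "\<psi> = affine_weyl_elt y u" "y \<in> coweight_lattice \<Delta>" "u \<in> weyl_group \<Phi>"
    "u ` \<Delta>\<^sub>e = \<Delta>\<^sub>e" using *(2) unfolding alcove_stabilizer_iff by blast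
  have "\<rho> (\<phi> \<otimes>\<^bsub>\<Omega>\<^esub> \<psi>) = restrict (w \<circ> u) \<Delta>\<^sub>e"
    unfolding alcove_stabilizer_mult[OF *] unfolding xw(1) yu(1) affine_weyl_elt_comp[OF xw(3) yu(3)]
    by (intro node_action_affine coweight_lattice_add coweight_lattice_contragredient weyl_comp xw yu)
  also have "\<dots> = \<rho> \<phi> \<otimes>\<^bsub>AutE\<^esub> \<rho> \<psi>"
    unfolding xw(1) yu(1) node_action_affine[OF xw(2,3)] node_action_affine[OF yu(2,3)]
    by (rule AutE_mult[OF weyl_root_aut[OF xw(3)] xw(4) weyl_root_aut[OF yu(3)] yu(4), symmetric])
  finally show "\<rho> (\<phi> \<otimes>\<^bsub>\<Omega>\<^esub> \<psi>) = \<rho> \<phi> \<otimes>\<^bsub>AutE\<^esub> \<rho> \<psi>" .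
next
  fix \<phi> \<psi> assume *: "\<phi> \<in> carrier \<Omega>" "\<psi> \<in> carrier \<Omega>" and eq: "\<rho> \<phi> = \<rho> \<psi>"
  obtain x w where xw: "\<phi> = affine_weyl_elt x w" "x \<in> coweight_lattice \<Delta>" "w \<in> weyl_group \<Phi>"
    and x: "\<forall>\<beta>\<in>\<Delta>\<^sub>e. blinfun_apply x \<beta> + level \<beta> = level (inv_into UNIV w \<beta>)"
    using *(1) unfolding alcove_stabilizer_iff by blast
  obtain y u where yu: "\<psi> = affine_weyl_elt y u" "y \<in> coweight_lattice \<Delta>" "u \<in> weyl_group \<Phi>"
    and y: "\<forall>\<beta>\<in>\<Delta>\<^sub>e. blinfun_apply y \<beta> + level \<beta> = level (inv_into UNIV u \<beta>)"
    using *(2) unfolding alcove_stabilizer_iff by blast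
  have "w = u"
    using eq unfolding xw(1) yu(1) node_action_affine[OF xw(2,3)] node_action_affine[OF yu(2,3)]
    by (rule root_aut_eq_if_restrict_eq[OF weyl_root_aut[OF xw(3)] weyl_root_aut[OF yu(3)]])
  have "x = y"
  proof (rule blinfun_eq_simple)
    fix \<alpha> assume "\<alpha> \<in> \<Delta>"
    hence "\<alpha> \<in> \<Delta>\<^sub>e" by (rule insertI2)
    from bspec[OF x this] bspec[OF y this] show "blinfun_apply x \<alpha> = blinfun_apply y \<alpha>"
      by (simp add: \<open>w = u\<close>)
  qed
  thus "\<phi> = \<psi>" by (simp only: xw(1) yu(1) \<open>w = u\<close>)
qed

lemma node_action_image:
  "\<rho> ` carrier \<Omega> = (\<lambda>w. restrict w \<Delta>\<^sub>e) ` {w \<in> weyl_group \<Phi>. w ` \<Delta>\<^sub>e = \<Delta>\<^sub>e}"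
proof (intro equalityI subsetI)
  fix \<sigma> assume "\<sigma> \<in> \<rho> ` carrier \<Omega>"
  then obtain \<phi> where "\<phi> \<in> carrier \<Omega>" "\<sigma> = \<rho> \<phi>" by (rule imageE) blast
  then obtain x w where "\<sigma> = \<rho> (affine_weyl_elt x w)" "x \<in> coweight_lattice \<Delta>" "w \<in> weyl_group \<Phi>"
    "w ` \<Delta>\<^sub>e = \<Delta>\<^sub>e" unfolding alcove_stabilizer_iff by blast
  thus "\<sigma> \<in> (\<lambda>w. restrict w \<Delta>\<^sub>e) ` {w \<in> weyl_group \<Phi>. w ` \<Delta>\<^sub>e = \<Delta>\<^sub>e}"
    by (intro image_eqI[of _ _ w]) (simp_all only: node_action_affine mem_Collect_eq)
next
  fix \<sigma> assume "\<sigma> \<in> (\<lambda>w. restrict w \<Delta>\<^sub>e) ` {w \<in> weyl_group \<Phi>. w ` \<Delta>\<^sub>e = \<Delta>\<^sub>e}"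
  then obtain w where w: "w \<in> weyl_group \<Phi>" "w ` \<Delta>\<^sub>e = \<Delta>\<^sub>e" "\<sigma> = restrict w \<Delta>\<^sub>e" by blast
  obtain x where x: "x \<in> coweight_lattice \<Delta>" "affine_weyl_elt x w \<in> carrier \<Omega>"
    using ex_alcove_stabilizer[OF w(1,2)] by blast
  show "\<sigma> \<in> \<rho> ` carrier \<Omega>"
    by (rule image_eqI[OF _ x(2)]) (simp only: w(3) node_action_affine[OF x(1) w(1)])
qed

lemma AutE_inv:
  assumes A: "A \<in> root_auts" "A ` \<Delta>\<^sub>e = \<Delta>\<^sub>e"
  shows "inv_into UNIV A ` \<Delta>\<^sub>e = \<Delta>\<^sub>e"
    and "inv\<^bsub>AutE\<^esub> (restrict A \<Delta>\<^sub>e) = restrict (inv_into UNIV A) \<Delta>\<^sub>e"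
proof -
  note bij = root_aut_bij[OF A(1)]
  show img: "inv_into UNIV A ` \<Delta>\<^sub>e = \<Delta>\<^sub>e"
    using image_inv_f_f[OF bij_is_inj[OF bij], of "\<Delta>\<^sub>e"] by (simp only: A(2))
  have "restrict (inv_into UNIV A) \<Delta>\<^sub>e \<otimes>\<^bsub>AutE\<^esub> restrict A \<Delta>\<^sub>e = restrict (inv_into UNIV A \<circ> A) \<Delta>\<^sub>e"
    by (rule AutE_mult[OF root_aut_inv[OF A(1)] img A])
  also have "inv_into UNIV A \<circ> A = id" using bij by (simp only: inv_o_cancel bij_is_inj)
  also have "restrict id \<Delta>\<^sub>e = \<one>\<^bsub>AutE\<^esub>" by (rule AutE_one[symmetric])
  finally have one: "restrict (inv_into UNIV A) \<Delta>\<^sub>e \<otimes>\<^bsub>AutE\<^esub> restrict A \<Delta>\<^sub>e = \<one>\<^bsub>AutE\<^esub>" .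
  have "restrict A \<Delta>\<^sub>e \<in> carrier AutE" "restrict (inv_into UNIV A) \<Delta>\<^sub>e \<in> carrier AutE"
    unfolding AutE_carrier using A img root_aut_inv[OF A(1)] by blast+
  with one show "inv\<^bsub>AutE\<^esub> (restrict A \<Delta>\<^sub>e) = restrict (inv_into UNIV A) \<Delta>\<^sub>e"
    by (intro group.inv_equality[OF group_diagram_auts])
qed

lemma node_action_image_normal: "\<rho> ` carrier \<Omega> \<lhd> AutE"
proof (rule group.normal_invI[OF group_diagram_auts])
  have "group_hom \<Omega> AutE \<rho>"
    using node_action_mon group_alcove_stabilizer group_diagram_auts
    by (simp add: group_hom_def group_hom_axioms_def mon_def)
  thus "subgroup (\<rho> ` carrier \<Omega>) AutE" by (rule group_hom.img_is_subgroup)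
next
  fix \<sigma> \<kappa> assume \<sigma>: "\<sigma> \<in> carrier AutE" and \<kappa>: "\<kappa> \<in> \<rho> ` carrier \<Omega>"
  obtain A where A: "A \<in> root_auts" "A ` \<Delta>\<^sub>e = \<Delta>\<^sub>e" "\<sigma> = restrict A \<Delta>\<^sub>e"
    using \<sigma> unfolding AutE_carrier by blast
  obtain w where w: "w \<in> weyl_group \<Phi>" "w ` \<Delta>\<^sub>e = \<Delta>\<^sub>e" "\<kappa> = restrict w \<Delta>\<^sub>e"
    using \<kappa> unfolding node_action_image by blast
  note w' = weyl_root_aut[OF w(1)]
  note invA = AutE_inv[OF A(1,2)]
  have Aw: "(A \<circ> w) ` \<Delta>\<^sub>e = \<Delta>\<^sub>e" by (simp only: image_comp[symmetric] A(2) w(2))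
  have Awv: "(A \<circ> w \<circ> inv_into UNIV A) ` \<Delta>\<^sub>e = \<Delta>\<^sub>e"
    by (simp only: image_comp[symmetric] A(2) w(2) invA(1))
  have "\<sigma> \<otimes>\<^bsub>AutE\<^esub> \<kappa> \<otimes>\<^bsub>AutE\<^esub> inv\<^bsub>AutE\<^esub> \<sigma> = restrict (A \<circ> w \<circ> inv_into UNIV A) \<Delta>\<^sub>e"
    unfolding A(3) w(3) invA(2) AutE_mult[OF A(1,2) w' w(2)]
    by (rule AutE_mult[OF root_aut_comp[OF A(1) w'] Aw root_aut_inv[OF A(1)] invA(1)])
  thus "\<sigma> \<otimes>\<^bsub>AutE\<^esub> \<kappa> \<otimes>\<^bsub>AutE\<^esub> inv\<^bsub>AutE\<^esub> \<sigma> \<in> \<rho> ` carrier \<Omega>"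
    unfolding node_action_image using root_aut_conj_weyl[OF A(1) w(1)] Awv by blast
qed

lemma node_action_image_inter:
  "\<rho> ` carrier \<Omega> \<inter> extend_aut \<Delta> \<alpha>\<^sub>0 ` carrier AutD \<subseteq> {\<one>\<^bsub>AutE\<^esub>}"
proof (intro subsetI, elim IntE)
  fix \<sigma> assume \<sigma>: "\<sigma> \<in> \<rho> ` carrier \<Omega>" "\<sigma> \<in> extend_aut \<Delta> \<alpha>\<^sub>0 ` carrier AutD"
  obtain w where w: "w \<in> weyl_group \<Phi>" "\<sigma> = restrict w \<Delta>\<^sub>e"
    using \<sigma>(1) unfolding node_action_image by blast
  obtain A where A: "A \<in> root_auts" "A ` \<Delta> = \<Delta>" "\<sigma> = extend_aut \<Delta> \<alpha>\<^sub>0 (restrict A \<Delta>)"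
    using \<sigma>(2) unfolding AutD_carrier by blast
  have "restrict w \<Delta>\<^sub>e = restrict A \<Delta>\<^sub>e"
    using w(2) A(3) unfolding extend_aut_restrict[OF A(1,2)] by simp
  hence "w = A" by (rule root_aut_eq_if_restrict_eq[OF weyl_root_aut[OF w(1)] A(1)])
  hence "w ` \<Delta> \<subseteq> pos" using simple_pos by (simp only: A(2) subset_iff) blast
  hence "w = id" by (rule weyl_eq_id_if_simple_pos[OF w(1)])
  thus "\<sigma> \<in> {\<one>\<^bsub>AutE\<^esub>}" by (simp only: w(2) AutE_one singleton_iff)
qed

lemma AutE_factorization:
  assumes "\<sigma> \<in> carrier AutE"
  shows "\<exists>\<phi>\<in>carrier \<Omega>. \<exists>\<tau>\<in>carrier AutD. \<sigma> = \<rho> \<phi> \<otimes>\<^bsub>AutE\<^esub> extend_aut \<Delta> \<alpha>\<^sub>0 \<tau>"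
proof -
  obtain A where A: "A \<in> root_auts" "A ` \<Delta>\<^sub>e = \<Delta>\<^sub>e" "\<sigma> = restrict A \<Delta>\<^sub>e"
    using assms unfolding AutE_carrier by blast
  obtain u where u: "u \<in> weyl_group \<Phi>" "(A \<circ> u) ` \<Delta> = \<Delta>"
    using weyl_transitive[OF A(1)] by blast
  \<comment> \<open>\<open>B\<close> stabilizes \<open>\<Delta>\<close>, hence all extended nodes, and so does \<open>A B\<^sup>-\<^sup>1 = A u\<^sup>-\<^sup>1 A\<^sup>-\<^sup>1\<close>, which lies
    in the Weyl group.\<close>
  define B where "B = A \<circ> u"
  have B: "B \<in> root_auts" "B ` \<Delta> = \<Delta>"
    using root_aut_comp[OF A(1) weyl_root_aut[OF u(1)]] u(2) by (simp_all only: B_def)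
  note Be = root_aut_ext_nodes[OF B]
  define w where "w = A \<circ> inv_into UNIV B"
  have "w = A \<circ> inv_into UNIV u \<circ> inv_into UNIV A"
    using o_inv_distrib[OF root_aut_bij[OF A(1)] weyl_bij[OF u(1)]]
    by (simp only: w_def B_def o_assoc)
  hence w: "w \<in> weyl_group \<Phi>" using root_aut_conj_weyl[OF A(1) weyl_inv[OF u(1)]] by simp
  have we: "w ` \<Delta>\<^sub>e = \<Delta>\<^sub>e"
    by (simp only: w_def image_comp[symmetric] AutE_inv(1)[OF B(1) Be] A(2))
  have "w \<circ> B = A"
    using root_aut_bij[OF B(1)]
    by (simp only: w_def o_assoc[symmetric] inv_o_cancel bij_is_inj comp_id)
  have "\<sigma> = restrict w \<Delta>\<^sub>e \<otimes>\<^bsub>AutE\<^esub> extend_aut \<Delta> \<alpha>\<^sub>0 (restrict B \<Delta>)"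
    unfolding extend_aut_restrict[OF B] AutE_mult[OF weyl_root_aut[OF w] we B(1) Be] \<open>w \<circ> B = A\<close>
    by (rule A(3))
  moreover have "restrict w \<Delta>\<^sub>e \<in> \<rho> ` carrier \<Omega>" unfolding node_action_image using w we by blast
  then obtain \<phi> where "\<phi> \<in> carrier \<Omega>" "restrict w \<Delta>\<^sub>e = \<rho> \<phi>" by (rule imageE) blast
  moreover have "restrict B \<Delta> \<in> carrier AutD" unfolding AutD_carrier using B by blast
  ultimately show ?thesis by metis
qed

end

theorem corollary2p2p7:
  fixes \<Phi> \<Delta> :: "'a::euclidean_space set" and \<alpha>\<^sub>0 :: 'a
  assumes "irreducible_root_system \<Phi>"
    and "simple_system \<Phi> \<Delta>"
    and "highest_root \<Phi> \<Delta> \<alpha>\<^sub>0"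
  shows "let \<Omega> = alcove_stabilizer \<Phi> \<Delta> \<alpha>\<^sub>0;
             AutD = diagram_auts (dynkin_diagram \<Delta>);
             AutE = diagram_auts (extended_dynkin_diagram \<Delta> \<alpha>\<^sub>0);
             \<rho> = node_action \<Phi> \<Delta> \<alpha>\<^sub>0;
             \<iota> = extend_aut \<Delta> \<alpha>\<^sub>0
         in group \<Omega> \<and> group AutD \<and> group AutE \<and>
            \<rho> \<in> mon \<Omega> AutE \<and>
            (\<rho> ` carrier \<Omega>) \<lhd> AutE \<and>
            \<iota> \<in> mon AutD AutE \<and>
            (AutE Mod (\<rho> ` carrier \<Omega>)) \<cong> AutD \<and>
            (\<exists>\<theta> \<in> hom AutD (AutoGroup \<Omega>).
               (\<lambda>(\<phi>, \<sigma>). \<rho> \<phi> \<otimes>\<^bsub>AutE\<^esub> \<iota> \<sigma>) \<in> iso (semidirect_product \<Omega> AutD \<theta>) AutE)"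
proof -
  interpret highest_root_system \<Phi> \<Delta> \<alpha>\<^sub>0
    using assms by unfold_locales (simp_all add: irreducible_root_system_def)
  note split = split_extension_semidirect[OF group_diagram_auts group_alcove_stabilizer group_diagram_auts
      node_action_mon node_action_image_normal extend_aut_mon node_action_image_inter
      AutE_factorization]
  show ?thesis
    unfolding Let_def
    by (intro conjI group_alcove_stabilizer group_diagram_auts node_action_mon
        node_action_image_normal extend_aut_mon split)
qed

end
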